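(* Let $(G,\mathfrak S)$ be a hierarchically hyperbolic group with a BBF colouring and with the property that for some $\lambda$ every $\mathcal C U$, $U\in\mathfrak S$, is $(\lambda,\lambda)$-quasiisometric to a tree. Then every hierarchically quasiconvex subgroup $H<G$ has bounded packing.
   Context: HIERARCHICALLY HYPERBOLIC GROUPS. A hierarchically hyperbolic group (HHG) $(G,\mathfrak S)$ with constant $E$ consists of a finitely generated group $G$, with the word metric $\mathsf d_G$ of a fixed finite generating set, and a set $\mathfrak S$ of domains, such that the following hold. (1) Projections: each $U\in\mathfrak S$ has an $E$-hyperbolic geodesic space $\mathcal C U$ and an $(E,E)$-coarsely Lipschitz, $E$-coarsely onto coarse map $\pi_U:G\to\mathcal C U$ (points may be sent to nonempty sets of diameter at most $E$). Write $\mathsf d_U(x,y)=\mathsf d_{\mathcal C U}(\pi_U(x),\pi_U(y))$ for points or subsets $x,y$ of $G$, and $\mathsf d_U(x,b)=\mathsf d_{\mathcal C U}(\pi_U(x),b)$ for $b\subset\mathcal C U$. (2) Nesting: $\mathfrak S$ has a partial order $\sqsubseteq$ with a unique maximal element; $U\sqsubset V$ means $U\sqsubseteq V$ and $U\ne V$. If $U\sqsubset V$ there are a specified nonempty set $\rho^U_V\subset\mathcal C V$ of diameter at most $E$ and a coarse map $\rho^V_U:\mathcal C V\to\mathcal C U$. (3) Orthogonality: $\bot$ is a symmetric antireflexive relation on $\mathfrak S$; if $V\sqsubseteq W$ and $W\bot U$ then $V\bot U$; if $V\bot W$ then $V,W$ are not $\sqsubseteq$-comparable; for all $T\in\mathfrak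 S$ and $U\sqsubseteq T$ such that some $V\sqsubseteq T$ has $V\bot U$, there is $W\sqsubset T$ such that every $V\sqsubseteq T$ with $V\bot U$ satisfies $V\sqsubseteq W$. (4) Transversality and consistency: $U\pitchfork V$ (transverse) means $U,V$ are neither $\sqsubseteq$-comparable nor orthogonal; then there are specified nonempty sets $\rho^U_V\subset\mathcal C V$, $\rho^V_U\subset\mathcal C U$ of diameter at most $E$, with $\min\{\mathsf d_U(x,\rho^V_U),\mathsf d_V(x,\rho^U_V)\}\le E$ for all $x\in G$. If $U\sqsubset V$ then $\min\{\mathsf d_V(x,\rho^U_V),\operatorname{diam}(\pi_U(x)\cup\rho^V_U(\pi_V(x)))\}\le E$ for all $x\in G$. If $U\sqsubseteq V$ then $\mathsf d_{\mathcal C W}(\rho^U_W,\rho^V_W)\le E$ whenever $V\sqsubset W$, or $V\pitchfork W$ and $W\not\perp U$. (5) Finite complexity: $\sqsubset$-chains have uniformly bounded length. (6) Large links: there is $\lambda_0\ge1$ such that for $W\in\mathfrak S$, $x,x'\in G$ and $N=\lambda_0\mathsf d_W(x,x')+\lambda_0$, there are $T_1,\dots,T_{\lfloor N\rfloor}\sqsubset W$ such that every $T\sqsubset W$ satisfies $T\sqsubseteq T_j$ for some $j$ or $\mathsf d_T(x,x')<E$, and $\mathsf d_W(x,\rho^{T_j}_W)\le N$ for all $j$. (7) Bounded geodesic image: if $V\sqsubset W$ and $\gamma$ is a geodesic in $\mathcal C W$, then $\operatorname{diam}\rho^W_V(\gamma)\le E$ or $\gamma$ meets the $E$-neighbourhood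 of $\rho^V_W$. (8) Partial realisation: if $\{V_j\}$ are pairwise orthogonal and $p_j\in\pi_{V_j}(G)$, there is $x\in G$ with $\mathsf d_{V_j}(x,p_j)\le E$ for all $j$, and $\mathsf d_V(x,\rho^{V_j}_V)\le E$ whenever $V_j\sqsubset V$ or $V\pitchfork V_j$. (9) Uniqueness: there is a function $E:[0,\infty)\to[0,\infty)$ (with $E=E(0)$) such that if $\mathsf d_V(x,y)<\kappa$ for all $V\in\mathfrak S$ then $\mathsf d_G(x,y)<E(\kappa)$. (10) $G$ acts on $\mathfrak S$ with finitely many orbits, preserving $\sqsubseteq,\bot,\pitchfork$; each $g\in G$ has isometries $g:\mathcal C U\to\mathcal C gU$ ($U\in\mathfrak S$) such that the isometry of a product $g_1g_2$ is the composition of those of $g_1$ and $g_2$, and $g\pi_U(x)=\pi_{gU}(gx)$, $g\rho^U_V=\rho^{gU}_{gV}$ whenever $x\in G$ and $U\sqsubset V$ or $U\pitchfork V$. BBF COLOURING. A BBF colouring of $(G,\mathfrak S)$ is a decomposition $\mathfrak S=\bigsqcup_{i=1}^\chi\mathfrak S_i$ into finitely many $G$-invariant subsets such that any two distinct domains in the same $\mathfrak S_i$ are transverse. HIERARCHICAL QUASICONVEXITY. Let $k:[0,\infty)\to[0,\infty)$. A set $\mathcal Z\subset G$ is $k$-hierarchically quasiconvex if every $\pi_U(\mathcal Z)$ is $k(0)$-quasiconvex in $\mathcal C U$ and, for every $\kappa\ge0$, any $x\in G$ with $\mathsf d_U(x,\mathcal Z)\le\kappa$ for all $U\in\mathfrak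 S$ is $k(\kappa)$-close to $\mathcal Z$. It is hierarchically quasiconvex if this holds for some $k$. BOUNDED PACKING. A subgroup $H$ of $G$ has bounded packing if for each $R$ there is a number $N$ such that at most $N$ cosets of $H$ can be pairwise $R$-close in $G$ (pairwise at distance at most $R$). *)

theory Defs
  imports "HOL-Analysis.Abstract_Metric_Spaces" "HOL-Algebra.Left_Coset"
    "HOL-Algebra.Group_Action" "HOL-Algebra.Generated_Groups"
begin

text \<open>All distances between sets are infimal; the value of \<open>sdist\<close> on empty sets is
  irrelevant, since projections, the sets \<open>\<rho>\<close>, subgroups and cosets are nonempty.\<close>

definition sdist :: "('a \<Rightarrow> 'a \<Rightarrow> real) \<Rightarrow> 'a set \<Rightarrow> 'a set \<Rightarrow> real" where
  "sdist d A B = (INF (a, b)\<in>A \<times> B. d a b)"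

text \<open>The set \<open>A\<close> has diameter at most \<open>r\<close>. A predicate is used because a real-valued
  supremum is unspecified on unbounded sets.\<close>

definition mdiam_le :: "'a metric \<Rightarrow> 'a set \<Rightarrow> real \<Rightarrow> bool" where
  "mdiam_le m A r \<longleftrightarrow> (\<forall>a\<in>A. \<forall>b\<in>A. mdist m a b \<le> r)"

definition nbhd :: "'a metric \<Rightarrow> real \<Rightarrow> 'a set \<Rightarrow> 'a set" where
  "nbhd m r A = {x \<in> mspace m. \<exists>a\<in>A. mdist m x a \<le> r}"

text \<open>A coarse map is a set-valued function whose values at points satisfy \<open>coarse_point\<close>.\<close>

definition coarse_point :: "'a metric \<Rightarrow> real \<Rightarrow> 'a set \<Rightarrow> bool" where
  "coarse_point m r A \<longleftrightarrow> A \<noteq> {} \<and> A \<subseteq> mspace m \<and> mdiam_le m A r"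

definition geodesic_between :: "'a metric \<Rightarrow> 'a \<Rightarrow> 'a \<Rightarrow> 'a set \<Rightarrow> bool" where
  "geodesic_between m x y \<gamma> \<longleftrightarrow>
     (\<exists>c l. 0 \<le> l \<and> c 0 = x \<and> c l = y \<and> c ` {0..l} \<subseteq> mspace m \<and>
        (\<forall>s\<in>{0..l}. \<forall>t\<in>{0..l}. mdist m (c s) (c t) = \<bar>s - t\<bar>) \<and> \<gamma> = c ` {0..l})"

definition geodesic_space :: "'a metric \<Rightarrow> bool" where
  "geodesic_space m \<longleftrightarrow> (\<forall>x\<in>mspace m. \<forall>y\<in>mspace m. \<exists>\<gamma>. geodesic_between m x y \<gamma>)"

text \<open>Gromov hyperbolicity in the form of slim geodesic triangles.\<close>

definition hyperbolic :: "real \<Rightarrow> 'a metric \<Rightarrow> bool" where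
  "hyperbolic \<delta> m \<longleftrightarrow>
     (\<forall>x y z \<alpha> \<beta> \<gamma>. geodesic_between m x y \<alpha> \<and> geodesic_between m y z \<beta> \<and>
        geodesic_between m x z \<gamma> \<longrightarrow> \<gamma> \<subseteq> nbhd m \<delta> (\<alpha> \<union> \<beta>))"

definition quasiconvex :: "'a metric \<Rightarrow> real \<Rightarrow> 'a set \<Rightarrow> bool" where
  "quasiconvex m k Y \<longleftrightarrow>
     (\<forall>x\<in>Y. \<forall>y\<in>Y. \<forall>\<gamma>. geodesic_between m x y \<gamma> \<longrightarrow> \<gamma> \<subseteq> nbhd m k Y)"

definition isometry_onto :: "'a metric \<Rightarrow> 'b metric \<Rightarrow> ('a \<Rightarrow> 'b) \<Rightarrow> bool" where
  "isometry_onto m n f \<longleftrightarrow> f ` mspace m = mspace n \<and>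
     (\<forall>p\<in>mspace m. \<forall>q\<in>mspace m. mdist n (f p) (f q) = mdist m p q)"

text \<open>Trees may be infinite and locally infinite. A cycle is a list of at least three distinct
  vertices, consecutive ones adjacent, whose last vertex is adjacent to the first.\<close>

definition graph_tree :: "'t set \<Rightarrow> ('t \<times> 't) set \<Rightarrow> bool" where
  "graph_tree V F \<longleftrightarrow> V \<noteq> {} \<and> F \<subseteq> V \<times> V \<and> sym F \<and> irrefl F \<and>
     (\<forall>u\<in>V. \<forall>v\<in>V. (u, v) \<in> F\<^sup>*) \<and>
     \<not> (\<exists>vs. 3 \<le> length vs \<and> distinct vs \<and> successively (\<lambda>u v. (u, v) \<in> F) vs \<and>
           (last vs, hd vs) \<in> F)"

definition graph_dist :: "('t \<times> 't) set \<Rightarrow> 't \<Rightarrow> 't \<Rightarrow> nat" where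
  "graph_dist F u v = (LEAST n. (u, v) \<in> F ^^ n)"

text \<open>The tree is represented by its vertices with the path metric; passing to the geometric
  realisation with edges of length 1 only changes the quasiisometry constant.\<close>

definition quasiisometry_to_graph ::
  "real \<Rightarrow> 'a metric \<Rightarrow> 't set \<Rightarrow> ('t \<times> 't) set \<Rightarrow> ('a \<Rightarrow> 't) \<Rightarrow> bool" where
  "quasiisometry_to_graph L m V F f \<longleftrightarrow> f ` mspace m \<subseteq> V \<and>
     (\<forall>x\<in>mspace m. \<forall>y\<in>mspace m.
        mdist m x y / L - L \<le> real (graph_dist F (f x) (f y)) \<and>
        real (graph_dist F (f x) (f y)) \<le> L * mdist m x y + L) \<and>
     (\<forall>v\<in>V. \<exists>x\<in>mspace m. real (graph_dist F v (f x)) \<le> L)"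

definition word_length :: "('g, 'm) monoid_scheme \<Rightarrow> 'g set \<Rightarrow> 'g \<Rightarrow> nat" where
  "word_length G A g = (LEAST n. \<exists>ws. length ws = n \<and> set ws \<subseteq> A \<union> (\<lambda>a. inv\<^bsub>G\<^esub> a) ` A \<and>
     foldr (\<lambda>a b. a \<otimes>\<^bsub>G\<^esub> b) ws \<one>\<^bsub>G\<^esub> = g)"

definition word_dist :: "('g, 'm) monoid_scheme \<Rightarrow> 'g set \<Rightarrow> 'g \<Rightarrow> 'g \<Rightarrow> real" where
  "word_dist G A x y = real (word_length G A (inv\<^bsub>G\<^esub> x \<otimes>\<^bsub>G\<^esub> y))"

text \<open>As the word metric is left-invariant, the relevant cosets are the left cosets \<open>gH\<close>.\<close>

definition bounded_packing :: "('g, 'm) monoid_scheme \<Rightarrow> 'g set \<Rightarrow> 'g set \<Rightarrow> bool" where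
  "bounded_packing G A H \<longleftrightarrow>
     (\<forall>R::real. \<exists>N::nat. \<forall>\<C> \<subseteq> lcosets\<^bsub>G\<^esub> H.
        pairwise (\<lambda>C D. sdist (word_dist G A) C D \<le> R) \<C> \<longrightarrow> finite \<C> \<and> card \<C> \<le> N)"

text \<open>All the spaces \<open>\<C>U\<close> live in one ambient type \<open>'p\<close>, as a family of metric spaces with
  carriers. For \<open>U \<sqsubset> V\<close> or \<open>U\<close> transverse to \<open>V\<close>, the set \<open>\<rho>\<^sup>U\<^sub>V\<close> is \<open>rho X U V\<close>; for
  \<open>U \<sqsubset> V\<close>, the coarse map \<open>\<rho>\<^sup>V\<^sub>U : \<C>V \<rightarrow> \<C>U\<close> is \<open>rho_map X V U\<close>. The isometry
  \<open>\<C>U \<rightarrow> \<C>gU\<close> is \<open>dom_iso X g U\<close>.\<close>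

record ('g, 's, 'p) hhg_data =
  gens :: "'g set"
  domains :: "'s set"
  nest :: "'s \<Rightarrow> 's \<Rightarrow> bool"
  orth :: "'s \<Rightarrow> 's \<Rightarrow> bool"
  space_of :: "'s \<Rightarrow> 'p metric"
  proj :: "'s \<Rightarrow> 'g \<Rightarrow> 'p set"
  rho :: "'s \<Rightarrow> 's \<Rightarrow> 'p set"
  rho_map :: "'s \<Rightarrow> 's \<Rightarrow> 'p \<Rightarrow> 'p set"
  dom_act :: "'g \<Rightarrow> 's \<Rightarrow> 's"
  dom_iso :: "'g \<Rightarrow> 's \<Rightarrow> 'p \<Rightarrow> 'p"

definition proper_nest :: "('g, 's, 'p) hhg_data \<Rightarrow> 's \<Rightarrow> 's \<Rightarrow> bool" where
  "proper_nest X U V \<longleftrightarrow> nest X U V \<and> U \<noteq> V"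

definition transverse :: "('g, 's, 'p) hhg_data \<Rightarrow> 's \<Rightarrow> 's \<Rightarrow> bool" where
  "transverse X U V \<longleftrightarrow> \<not> nest X U V \<and> \<not> nest X V U \<and> \<not> orth X U V"

definition proj_set :: "('g, 's, 'p) hhg_data \<Rightarrow> 's \<Rightarrow> 'g set \<Rightarrow> 'p set" where
  "proj_set X U Z = (\<Union>z\<in>Z. proj X U z)"

definition dist_in :: "('g, 's, 'p) hhg_data \<Rightarrow> 's \<Rightarrow> 'p set \<Rightarrow> 'p set \<Rightarrow> real" where
  "dist_in X U = sdist (mdist (space_of X U))"

definition dproj :: "('g, 's, 'p) hhg_data \<Rightarrow> 's \<Rightarrow> 'g \<Rightarrow> 'g \<Rightarrow> real" where
  "dproj X U x y = dist_in X U (proj X U x) (proj X U y)"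

text \<open>In \<open>large_links\<close> the listed domains \<open>T\<^sub>1, \<dots>, T\<^sub>\<lfloor>\<^sub>N\<^sub>\<rfloor>\<close> are rendered as a set of at most
  \<open>\<lfloor>N\<rfloor>\<close> domains properly nested in \<open>W\<close>: there are none of them when \<open>W\<close> is
  \<open>\<sqsubseteq>\<close>-minimal, although \<open>\<lfloor>N\<rfloor> \<ge> 1\<close>.\<close>

locale hhg = group G for G :: "('g, 'm) monoid_scheme" (structure) +
  fixes X :: "('g, 's, 'p) hhg_data" and E :: real
  assumes gens: "finite (gens X)" "gens X \<subseteq> carrier G" "generate G (gens X) = carrier G"
    and spaces: "U \<in> domains X \<Longrightarrow> geodesic_space (space_of X U) \<and> hyperbolic E (space_of X U)"
    and proj_coarse: "U \<in> domains X \<Longrightarrow> x \<in> carrier G \<Longrightarrow>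
        coarse_point (space_of X U) E (proj X U x)"
    and proj_lipschitz: "U \<in> domains X \<Longrightarrow> x \<in> carrier G \<Longrightarrow> y \<in> carrier G \<Longrightarrow>
        dproj X U x y \<le> E * word_dist G (gens X) x y + E"
    and proj_onto: "U \<in> domains X \<Longrightarrow>
        mspace (space_of X U) \<subseteq> nbhd (space_of X U) E (proj_set X U (carrier G))"
    and nest_order: "reflp_on (domains X) (nest X)" "antisymp_on (domains X) (nest X)"
        "transp_on (domains X) (nest X)"
    and nest_max: "\<exists>!M. M \<in> domains X \<and> (\<forall>U\<in>domains X. nest X M U \<longrightarrow> U = M)"
    and rho_nest: "U \<in> domains X \<Longrightarrow> V \<in> domains X \<Longrightarrow> proper_nest X U V \<Longrightarrow>
        coarse_point (space_of X V) E (rho X U V)"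
    and rho_map_nest: "U \<in> domains X \<Longrightarrow> V \<in> domains X \<Longrightarrow> proper_nest X U V \<Longrightarrow>
        p \<in> mspace (space_of X V) \<Longrightarrow> coarse_point (space_of X U) E (rho_map X V U p)"
    and orth_rel: "symp_on (domains X) (orth X)" "irreflp_on (domains X) (orth X)"
    and orth_nest: "U \<in> domains X \<Longrightarrow> V \<in> domains X \<Longrightarrow> W \<in> domains X \<Longrightarrow>
        nest X V W \<Longrightarrow> orth X W U \<Longrightarrow> orth X V U"
    and orth_incomparable: "V \<in> domains X \<Longrightarrow> W \<in> domains X \<Longrightarrow> orth X V W \<Longrightarrow>
        \<not> nest X V W \<and> \<not> nest X W V"
    and orth_container: "T \<in> domains X \<Longrightarrow> U \<in> domains X \<Longrightarrow> nest X U T \<Longrightarrow>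
        \<exists>V\<in>domains X. nest X V T \<and> orth X V U \<Longrightarrow>
        \<exists>W\<in>domains X. proper_nest X W T \<and>
          (\<forall>V\<in>domains X. nest X V T \<and> orth X V U \<longrightarrow> nest X V W)"
    and rho_transverse: "U \<in> domains X \<Longrightarrow> V \<in> domains X \<Longrightarrow> transverse X U V \<Longrightarrow>
        coarse_point (space_of X V) E (rho X U V) \<and> coarse_point (space_of X U) E (rho X V U)"
    and consistency_transverse: "U \<in> domains X \<Longrightarrow> V \<in> domains X \<Longrightarrow> transverse X U V \<Longrightarrow>
        x \<in> carrier G \<Longrightarrow>
        min (dist_in X U (proj X U x) (rho X V U)) (dist_in X V (proj X V x) (rho X U V)) \<le> E"
    and consistency_nest: "U \<in> domains X \<Longrightarrow> V \<in> domains X \<Longrightarrow> proper_nest X U V \<Longrightarrow>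
        x \<in> carrier G \<Longrightarrow>
        dist_in X V (proj X V x) (rho X U V) \<le> E \<or>
        mdiam_le (space_of X U) (proj X U x \<union> (\<Union>p\<in>proj X V x. rho_map X V U p)) E"
    and consistency_rho: "U \<in> domains X \<Longrightarrow> V \<in> domains X \<Longrightarrow> W \<in> domains X \<Longrightarrow> nest X U V \<Longrightarrow>
        proper_nest X V W \<or> (transverse X V W \<and> \<not> orth X W U) \<Longrightarrow>
        dist_in X W (rho X U W) (rho X V W) \<le> E"
    and finite_complexity: "\<exists>n::nat. \<forall>\<C> \<subseteq> domains X.
        (\<forall>U\<in>\<C>. \<forall>V\<in>\<C>. nest X U V \<or> nest X V U) \<longrightarrow> finite \<C> \<and> card \<C> \<le> n"
    and large_links: "\<exists>L::real. 1 \<le> L \<and> (\<forall>W\<in>domains X. \<forall>x\<in>carrier G. \<forall>x'\<in>carrier G.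
        let N = L * dproj X W x x' + L in
        \<exists>\<T> \<subseteq> {T \<in> domains X. proper_nest X T W}. finite \<T> \<and> card \<T> \<le> nat \<lfloor>N\<rfloor> \<and>
          (\<forall>T\<in>domains X. proper_nest X T W \<longrightarrow> (\<exists>T'\<in>\<T>. nest X T T') \<or> dproj X T x x' < E) \<and>
          (\<forall>T\<in>\<T>. dist_in X W (proj X W x) (rho X T W) \<le> N))"
    and bounded_geodesic_image: "V \<in> domains X \<Longrightarrow> W \<in> domains X \<Longrightarrow> proper_nest X V W \<Longrightarrow>
        geodesic_between (space_of X W) a b \<gamma> \<Longrightarrow>
        mdiam_le (space_of X V) (\<Union>p\<in>\<gamma>. rho_map X W V p) E \<or>
        \<gamma> \<inter> nbhd (space_of X W) E (rho X V W) \<noteq> {}"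
    and partial_realisation: "\<V> \<subseteq> domains X \<Longrightarrow> pairwise (orth X) \<V> \<Longrightarrow>
        (\<And>V. V \<in> \<V> \<Longrightarrow> pt V \<in> proj_set X V (carrier G)) \<Longrightarrow>
        \<exists>x\<in>carrier G. \<forall>V\<in>\<V>. dist_in X V (proj X V x) {pt V} \<le> E \<and>
          (\<forall>U\<in>domains X. proper_nest X V U \<or> transverse X U V \<longrightarrow>
             dist_in X U (proj X U x) (rho X V U) \<le> E)"
    and uniqueness: "\<exists>\<theta>::real \<Rightarrow> real. \<theta> 0 = E \<and> (\<forall>\<kappa>\<ge>0. 0 \<le> \<theta> \<kappa> \<and>
        (\<forall>x\<in>carrier G. \<forall>y\<in>carrier G.
           (\<forall>V\<in>domains X. dproj X V x y < \<kappa>) \<longrightarrow> word_dist G (gens X) x y < \<theta> \<kappa>))"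
    and action: "group_action G (domains X) (dom_act X)"
    and cofinite: "finite (orbits G (domains X) (dom_act X))"
    and act_relations: "g \<in> carrier G \<Longrightarrow> U \<in> domains X \<Longrightarrow> V \<in> domains X \<Longrightarrow>
        (nest X (dom_act X g U) (dom_act X g V) \<longleftrightarrow> nest X U V) \<and>
        (orth X (dom_act X g U) (dom_act X g V) \<longleftrightarrow> orth X U V) \<and>
        (transverse X (dom_act X g U) (dom_act X g V) \<longleftrightarrow> transverse X U V)"
    and act_iso: "g \<in> carrier G \<Longrightarrow> U \<in> domains X \<Longrightarrow>
        isometry_onto (space_of X U) (space_of X (dom_act X g U)) (dom_iso X g U)"
    and act_comp: "g \<in> carrier G \<Longrightarrow> h \<in> carrier G \<Longrightarrow> U \<in> domains X \<Longrightarrow>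
        p \<in> mspace (space_of X U) \<Longrightarrow>
        dom_iso X (g \<otimes> h) U p = dom_iso X g (dom_act X h U) (dom_iso X h U p)"
    and act_proj: "g \<in> carrier G \<Longrightarrow> U \<in> domains X \<Longrightarrow> x \<in> carrier G \<Longrightarrow>
        dom_iso X g U ` proj X U x = proj X (dom_act X g U) (g \<otimes> x)"
    and act_rho: "g \<in> carrier G \<Longrightarrow> U \<in> domains X \<Longrightarrow> V \<in> domains X \<Longrightarrow>
        proper_nest X U V \<or> transverse X U V \<Longrightarrow>
        dom_iso X g V ` rho X U V = rho X (dom_act X g U) (dom_act X g V)"

definition BBF_colouring ::
  "('g, 'm) monoid_scheme \<Rightarrow> ('g, 's, 'p) hhg_data \<Rightarrow> nat \<Rightarrow> (nat \<Rightarrow> 's set) \<Rightarrow> bool" where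
  "BBF_colouring G X n \<SS> \<longleftrightarrow>
     domains X = (\<Union>i\<in>{1..n}. \<SS> i) \<and> disjoint_family_on \<SS> {1..n} \<and>
     (\<forall>i\<in>{1..n}. (\<forall>g\<in>carrier G. \<forall>U\<in>\<SS> i. dom_act X g U \<in> \<SS> i) \<and>
        pairwise (transverse X) (\<SS> i))"

definition hier_quasiconvex_with ::
  "(real \<Rightarrow> real) \<Rightarrow> ('g, 'm) monoid_scheme \<Rightarrow> ('g, 's, 'p) hhg_data \<Rightarrow> 'g set \<Rightarrow> bool" where
  "hier_quasiconvex_with k G X Z \<longleftrightarrow>
     (\<forall>U\<in>domains X. quasiconvex (space_of X U) (k 0) (proj_set X U Z)) \<and>
     (\<forall>\<kappa>\<ge>0. \<forall>x\<in>carrier G.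
        (\<forall>U\<in>domains X. dist_in X U (proj X U x) (proj_set X U Z) \<le> \<kappa>) \<longrightarrow>
        sdist (word_dist G (gens X)) {x} Z \<le> k \<kappa>)"

definition hier_quasiconvex ::
  "('g, 'm) monoid_scheme \<Rightarrow> ('g, 's, 'p) hhg_data \<Rightarrow> 'g set \<Rightarrow> bool" where
  "hier_quasiconvex G X Z \<longleftrightarrow>
     (\<exists>k. (\<forall>\<kappa>\<ge>0. 0 \<le> k \<kappa>) \<and> hier_quasiconvex_with k G X Z)"

end

theory Submission
  imports Defs
begin

text \<open>Pairwise close cosets of \<open>H\<close> have pairwise close quasiconvex projections to every hyperbolic
  space \<open>\<C>U\<close>, so by the coarse Helly property of \<open>\<C>U\<close> a nearest point to \<open>\<pi>\<^sub>U(\<one>)\<close> in the projection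
  of the farthest coset is close to the projections of all cosets. These points form a consistent
  tuple, and consistent tuples are realised by points of \<open>G\<close>. The realising point is close to all
  the cosets by hierarchical quasiconvexity, hence their number is at most the size of a ball.

  For the realisation of a consistent tuple \<open>b\<close>, partial realisation is applied to a maximal
  orthogonal family of domains \<open>V\<close> chosen such that \<open>b\<^sub>U\<close> is close to \<open>\<rho>\<^sup>V\<^sub>U\<close> for the relevant \<open>U\<close>
  above or transverse to \<open>V\<close>, and \<open>b\<^sub>V\<close> is far from \<open>\<rho>\<^sup>U\<^sub>V\<close> for all \<open>U \<sqsubset> V\<close>. The colouring only serves
  to bound the size of orthogonal families.\<close>

section \<open>Realisation of consistent tuples\<close>

text \<open>The coset and the point \<open>b U\<close> are chosen in each space separately, so the
  tuple is not the projection of one group element and its consistency has to be derived from the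
  nearest-point property. Partial realisation controls the projection to \<open>U\<close> only if
  \<open>U\<close> is in the chosen orthogonal family, or lies above or transverse to a member. Two
  kinds of domains escape it. For \<open>U\<close> properly below a member \<open>V\<close>, the
  value \<open>b V\<close> determines \<open>b U\<close> coarsely by bounded geodesic image, but
  only while \<open>b V\<close> stays away from \<open>\<rho> U V\<close>; this is why
  \<open>V\<close> is taken \<sqsubseteq>-minimal. Domains orthogonal to every member can only be
  reached by enlarging the family, which needs the bound on its size. No constant depends on the
  number of cosets, so a bound proved for finite families also excludes infinite ones.\<close>

text \<open>One constant \<open>c\<close> bounds all errors, and \<open>d U\<close> is only a pseudometric. For \<open>V \<sqsubset> U\<close> and for
  transverse \<open>V\<close>, \<open>U\<close>, the set \<open>\<rho>\<^sup>V\<^sub>U\<close> is represented by the point \<open>\<rho> V U\<close>. The assumption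
  \<open>tuple_nest\<close> is all that is needed from the maps \<open>\<rho>\<^sup>V\<^sub>U : \<C>V \<rightarrow> \<C>U\<close>: consistency of \<open>y\<close> and of
  the tuple combined with bounded geodesic image for a geodesic from \<open>\<pi> V y\<close> to \<open>b V\<close>.\<close>

locale consistent_tuple =
  fixes D :: "'s set"
    and nest orth :: "'s \<Rightarrow> 's \<Rightarrow> bool"
    and d :: "'s \<Rightarrow> 'p \<Rightarrow> 'p \<Rightarrow> real"
    and Y :: "'g set"
    and \<pi> :: "'s \<Rightarrow> 'g \<Rightarrow> 'p"
    and \<rho> :: "'s \<Rightarrow> 's \<Rightarrow> 'p"
    and b :: "'s \<Rightarrow> 'p"
    and c :: real
    and N :: nat
  assumes d_sym: "d U p q = d U q p"
    and d_triangle: "U \<in> D \<Longrightarrow> d U p r \<le> d U p q + d U q r"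
    and nest_refl: "U \<in> D \<Longrightarrow> nest U U"
    and nest_antisym: "U \<in> D \<Longrightarrow> V \<in> D \<Longrightarrow> nest U V \<Longrightarrow> nest V U \<Longrightarrow> U = V"
    and nest_trans: "U \<in> D \<Longrightarrow> V \<in> D \<Longrightarrow> W \<in> D \<Longrightarrow> nest U V \<Longrightarrow> nest V W \<Longrightarrow> nest U W"
    and nest_minimal: "A \<subseteq> D \<Longrightarrow> A \<noteq> {} \<Longrightarrow> \<exists>V\<in>A. \<forall>U\<in>A. nest U V \<longrightarrow> U = V"
    and orth_sym: "U \<in> D \<Longrightarrow> V \<in> D \<Longrightarrow> orth U V \<Longrightarrow> orth V U"
    and orth_nest: "U \<in> D \<Longrightarrow> V \<in> D \<Longrightarrow> W \<in> D \<Longrightarrow> nest V W \<Longrightarrow> orth W U \<Longrightarrow> orth V U"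
    and orth_not_nest: "U \<in> D \<Longrightarrow> V \<in> D \<Longrightarrow> orth U V \<Longrightarrow> \<not> nest U V"
    and orth_card: "A \<subseteq> D \<Longrightarrow> pairwise orth A \<Longrightarrow> finite A \<and> card A \<le> N"
    and point_consistent: "U \<in> D \<Longrightarrow> V \<in> D \<Longrightarrow> \<not> nest U V \<Longrightarrow> \<not> nest V U \<Longrightarrow> \<not> orth U V \<Longrightarrow>
        y \<in> Y \<Longrightarrow> d U (\<pi> U y) (\<rho> V U) \<le> c \<or> d V (\<pi> V y) (\<rho> U V) \<le> c"
    and tuple_consistent: "U \<in> D \<Longrightarrow> V \<in> D \<Longrightarrow> \<not> nest U V \<Longrightarrow> \<not> nest V U \<Longrightarrow> \<not> orth U V \<Longrightarrow>
        d U (b U) (\<rho> V U) \<le> c \<or> d V (b V) (\<rho> U V) \<le> c"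
    and tuple_nest: "U \<in> D \<Longrightarrow> V \<in> D \<Longrightarrow> nest U V \<Longrightarrow> U \<noteq> V \<Longrightarrow> y \<in> Y \<Longrightarrow>
        d V (b V) (\<rho> U V) > d V (\<pi> V y) (b V) + c \<Longrightarrow> d U (\<pi> U y) (b U) \<le> c"
    and rho_consistent: "U \<in> D \<Longrightarrow> V \<in> D \<Longrightarrow> W \<in> D \<Longrightarrow> nest U V \<Longrightarrow> \<not> nest W V \<Longrightarrow>
        \<not> orth V W \<Longrightarrow> \<not> orth U W \<Longrightarrow> d W (\<rho> U W) (\<rho> V W) \<le> c"
    and realise: "A \<subseteq> D \<Longrightarrow> pairwise orth A \<Longrightarrow>
        \<exists>y\<in>Y. \<forall>V\<in>A. d V (\<pi> V y) (b V) \<le> c \<and>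
          (\<forall>U\<in>D. \<not> nest U V \<and> \<not> orth V U \<longrightarrow> d U (\<pi> U y) (\<rho> V U) \<le> c)"
    and finite_relevant: "y \<in> Y \<Longrightarrow> finite {U \<in> D. d U (\<pi> U y) (b U) > 4 * c}"
begin

text \<open>This means that \<open>V\<close> is properly nested in \<open>U\<close> or transverse to
  it, which is exactly when the point \<open>\<rho> V U\<close> is meaningful.\<close>

abbreviation sees :: "'s \<Rightarrow> 's \<Rightarrow> bool" where
  "sees V U \<equiv> \<not> nest U V \<and> \<not> orth V U"

text \<open>This is the conclusion of partial realisation for one member. It is silent about domains
  properly below \<open>V\<close> or orthogonal to \<open>V\<close>.\<close>

definition realises :: "'g \<Rightarrow> 's \<Rightarrow> bool" where
  "realises y V \<longleftrightarrow> d V (\<pi> V y) (b V) \<le> c \<and> (\<forall>U\<in>D. sees V U \<longrightarrow> d U (\<pi> U y) (\<rho> V U) \<le> c)"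

lemma realises_ex: "A \<subseteq> D \<Longrightarrow> pairwise orth A \<Longrightarrow> \<exists>y\<in>Y. \<forall>V\<in>A. realises y V"
  unfolding realises_def by (rule realise)

lemma realises_one: "V \<in> D \<Longrightarrow> \<exists>y\<in>Y. realises y V"
  using realises_ex[of "{V}"] by auto

lemma triangle:
  assumes "U \<in> D"
  shows "d U p r \<le> d U p q + d U q r" "d U p r \<le> d U p q + d U r q"
    "d U p r \<le> d U q p + d U q r" "d U p r \<le> d U q p + d U r q"
  using d_triangle[OF assms, of p r q] d_sym by metis+

lemma d_nonneg: "U \<in> D \<Longrightarrow> 0 \<le> d U p q"
  using triangle(1)[of U p p q] triangle(1)[of U p q p] d_sym[of U p q] by linarith

lemma above_not_orth: "U \<in> D \<Longrightarrow> V \<in> D \<Longrightarrow> nest V U \<Longrightarrow> \<not> orth V U"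
  using orth_not_nest by blast

text \<open>Orthogonality of \<open>V\<close> and \<open>U\<close> would descend to
  \<open>V'\<close>. The lemma carries estimates at \<open>V\<close> to all domains below it, at the
  price of one \<open>c\<close>.\<close>

lemma sees_below_sees:
  assumes "U \<in> D" "V \<in> D" "V' \<in> D" "nest V' V" "sees V' U" "\<not> nest U V"
  shows "sees V U" "d U (\<rho> V' U) (\<rho> V U) \<le> c"
proof -
  show "sees V U" using assms orth_nest by blast
  then show "d U (\<rho> V' U) (\<rho> V U) \<le> c" using rho_consistent assms by blast
qed

text \<open>The domains in which \<open>y\<close> is far from the tuple are ordered as they are met on the way from
  \<open>y\<close> to the tuple. Restricting this order to the \<open>\<sqsubseteq>\<close>-maximal ones makes it transitive with no
  loss in the constants; the domain sought is a last one.\<close>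

lemma last_relevant_sees_tuple:
  assumes y: "y \<in> Y" and UU: "\<U> \<subseteq> D"
    and R: "R = {U \<in> \<U>. d U (\<pi> U y) (b U) > 4 * c}" and "R \<noteq> {}"
  shows "\<exists>V\<in>R. \<forall>U\<in>\<U>. sees V U \<longrightarrow> d U (b U) (\<rho> V U) \<le> 5 * c"
proof -
  have RD: "R \<subseteq> D" using UU R by auto
  have finR: "finite R" by (rule finite_subset[OF _ finite_relevant[OF y]]) (use UU R in auto)
  have far: "d U (\<pi> U y) (b U) > 4 * c" if "U \<in> R" for U using that R by auto
  define M where "M = {V \<in> R. \<forall>U\<in>R. nest V U \<longrightarrow> U = V}"
  have MR: "M \<subseteq> R" and MD: "M \<subseteq> D" using RD by (auto simp: M_def)
  have below_M: "\<exists>V\<in>M. nest U V" if U: "U \<in> R" for U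
  proof -
    let ?A = "{V \<in> R. nest U V}"
    have "asymp_on ?A (\<lambda>V W. nest V W \<and> V \<noteq> W)"
      by (rule asymp_onI) (use RD nest_antisym in blast)
    moreover have "transp_on ?A (\<lambda>V W. nest V W \<and> V \<noteq> W)"
      by (rule transp_onI) (use RD nest_antisym nest_trans in blast)
    moreover have "finite ?A" "?A \<noteq> {}" using finR U RD nest_refl by auto
    ultimately obtain V where V: "V \<in> ?A" "\<forall>W\<in>?A. W \<noteq> V \<longrightarrow> \<not> (nest V W \<and> V \<noteq> W)"
      using Finite_Set.bex_max_element[of ?A "\<lambda>V W. nest V W \<and> V \<noteq> W"] by blast
    moreover have "V \<in> M"
      using V RD U nest_trans unfolding M_def by (smt (verit, best) mem_Collect_eq subset_iff)
    ultimately show ?thesis by blast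
  qed
  \<comment> \<open>Going from \<open>y\<close> to the tuple, \<open>V\<close> is crossed first: in
    \<open>U\<close> the point \<open>y\<close> still sits at \<open>\<rho> V U\<close>, and by
    \<open>tuple_before\<close> the tuple already sits at \<open>\<rho> U V\<close> in
    \<open>V\<close>.\<close>
  define before where "before V U \<longleftrightarrow> \<not> nest V U \<and> sees V U \<and> d U (\<pi> U y) (\<rho> V U) \<le> c" for V U
  have M_cases: "V = U \<or> orth V U \<or> \<not> nest V U \<and> sees V U" if "V \<in> M" "U \<in> M" for U V
    using that by (auto simp: M_def)
  have before_total: "before V U \<or> before U V"
    if "V \<in> R" "U \<in> R" "\<not> nest V U" "sees V U" for U V
  proof -
    have "sees U V" using that RD orth_sym by blast
    then show ?thesis
      using point_consistent[of U V y] that RD y unfolding before_def by blast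
  qed
  have tuple_before: "d V (b V) (\<rho> U V) \<le> c"
    if "V \<in> R" "U \<in> R" "before V U" for U V
  proof -
    have *: "U \<in> D" "V \<in> D" "\<not> nest U V" "\<not> nest V U" "\<not> orth U V" "\<not> orth V U" "d U (\<pi> U y) (\<rho> V U) \<le> c"
      using that RD orth_sym unfolding before_def by blast+
    have "d U (b U) (\<rho> V U) > c"
      using triangle(2)[OF *(1), of "\<pi> U y" "b U" "\<rho> V U"] far[OF that(2)] *(7) d_nonneg[OF *(1), of "\<pi> U y" "\<rho> V U"] by linarith
    then show ?thesis using tuple_consistent[of U V] * by linarith
  qed
  have before_asym: "\<not> before U V" if "V \<in> R" "U \<in> R" "before V U" for U V
  proof
    have V: "V \<in> D" using that RD by blast
    assume "before U V"
    then have "d V (\<pi> V y) (\<rho> U V) \<le> c" unfolding before_def by blast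
    then show False
      using triangle(2)[OF V, of "\<pi> V y" "b V" "\<rho> U V"] far[OF that(1)] tuple_before[OF that]
        d_nonneg[OF V, of "\<pi> V y" "\<rho> U V"] by linarith
  qed
  have before_trans: "before V W"
    if M3: "V \<in> M" "U \<in> M" "W \<in> M" and VU: "before V U" and UW: "before U W" for U V W
  proof -
    have R3: "V \<in> R" "U \<in> R" "W \<in> R" and D3: "V \<in> D" "U \<in> D" "W \<in> D" using M3 MR MD by auto
    have y1: "d U (\<pi> U y) (\<rho> V U) \<le> c" and y2: "d W (\<pi> W y) (\<rho> U W) \<le> c"
      using VU UW unfolding before_def by auto
    have b1: "d U (b U) (\<rho> W U) \<le> c" using tuple_before UW R3 by blast
    have sVU: "sees V U" "sees W U"
      using VU UW D3 orth_sym unfolding before_def by blast+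
    \<comment> \<open>In \<open>U\<close>, the point \<open>y\<close> is near
      \<open>\<rho> V U\<close> and the tuple is near \<open>\<rho> W U\<close>, while the two are
      more than \<open>4 * c\<close> apart. If \<open>V\<close> and \<open>W\<close> are orthogonal,
      or if \<open>W\<close> is before \<open>V\<close>, some \<open>z\<close> projects within
      \<open>c\<close> of both points, which is impossible.\<close>
    have absurd: "d U (\<rho> V U) (\<rho> W U) > 2 * c"
      using triangle(2)[OF D3(2), of "\<pi> U y" "b U" "\<rho> W U"]
        triangle(1)[OF D3(2), of "\<pi> U y" "\<rho> W U" "\<rho> V U"] y1 b1 far[OF R3(2)] by linarith
    from M_cases[of V W] M3 consider "V = W" | "orth V W" | "\<not> nest V W" "sees V W" by blast
    then show ?thesis
    proof cases
      case 1
      then show ?thesis using before_asym VU UW R3 by blast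
    next
      case 2
      then have "pairwise orth {V, W}" using orth_sym D3 by (auto simp: pairwise_def)
      then obtain z where "realises z V" "realises z W"
        using realises_ex[of "{V, W}"] D3 by auto
      then have "d U (\<pi> U z) (\<rho> V U) \<le> c" "d U (\<pi> U z) (\<rho> W U) \<le> c"
        using sVU D3 unfolding realises_def by blast+
      then show ?thesis
        using absurd triangle(3)[OF D3(2), of "\<rho> V U" "\<rho> W U" "\<pi> U z"] by linarith
    next
      case 3
      show ?thesis
      proof (rule ccontr)
        assume "\<not> before V W"
        then have WV: "before W V" using before_total[of V W] 3 R3 by blast
        then have bW: "d W (b W) (\<rho> V W) \<le> c" using tuple_before R3 by blast
        obtain z where z: "z \<in> Y" "realises z V" using realises_one D3 by blast
        have zU: "d U (\<pi> U z) (\<rho> V U) \<le> c" and zW: "d W (\<pi> W z) (\<rho> V W) \<le> c"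
          using z(2) sVU 3 D3 unfolding realises_def by blast+
        \<comment> \<open>In \<open>W\<close>, \<open>z\<close> is within \<open>2 * c\<close> of
          \<open>b W\<close>, since both are near \<open>\<rho> V W\<close>, and \<open>y\<close> is
          within \<open>c\<close> of \<open>\<rho> U W\<close>. This leaves more than 4c -
          3c.\<close>
        have "d W (\<pi> W z) (\<rho> U W) > c"
          using triangle(2)[OF D3(3), of "\<pi> W z" "b W" "\<rho> V W"]
            triangle(2)[OF D3(3), of "\<pi> W y" "b W" "\<pi> W z"] d_sym[of W "\<pi> W z" "b W"]
            triangle(2)[OF D3(3), of "\<pi> W y" "\<pi> W z" "\<rho> U W"]
            zW bW y2 far[OF R3(3)] by linarith
        then have zU': "d U (\<pi> U z) (\<rho> W U) \<le> c"
          using point_consistent[of U W z] z(1) UW D3 unfolding before_def by fastforce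
        show False
          using absurd triangle(3)[OF D3(2), of "\<rho> V U" "\<rho> W U" "\<pi> U z"] zU zU' by linarith
      qed
    qed
  qed
  have "asymp_on M before" by (rule asymp_onI) (use before_asym MR in blast)
  moreover have "transp_on M before" by (rule transp_onI) (use before_trans in blast)
  moreover have "finite M" "M \<noteq> {}"
    using finite_subset[OF MR finR] below_M \<open>R \<noteq> {}\<close> by blast+
  ultimately obtain V where V: "V \<in> M" "\<forall>U\<in>M. U \<noteq> V \<longrightarrow> \<not> before V U"
    using Finite_Set.bex_max_element[of M before] by blast
  have VR: "V \<in> R" and VD: "V \<in> D" using V(1) MR MD by auto
  have "d U (b U) (\<rho> V U) \<le> 5 * c" if U: "U \<in> \<U>" and sees: "sees V U" for U
  proof (rule ccontr)
    assume "\<not> ?thesis"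
    then have bU: "d U (b U) (\<rho> V U) > 5 * c" by simp
    have UD: "U \<in> D" using U UU by auto
    show False
    proof (cases "nest V U")
      case True
      moreover have "U \<noteq> V" using sees nest_refl VD by blast
      \<comment> \<open>Since \<open>V\<close> is maximal in \<open>R\<close>, the domain
        \<open>U\<close> above it is not relevant. The bound \<open>5 * c\<close> is chosen as
        \<open>4 * c\<close> plus the margin \<open>c\<close> that \<open>tuple_nest\<close> asks
        for.\<close>
      ultimately have "U \<notin> R" using V(1) unfolding M_def by blast
      then have "d U (\<pi> U y) (b U) \<le> 4 * c" using U R by auto
      then have "d V (\<pi> V y) (b V) \<le> c"
        using tuple_nest[of V U y] True \<open>U \<noteq> V\<close> UD VD y bU by auto
      then show False using far[OF VR] d_nonneg[OF VD, of "\<pi> V y" "b V"] by linarith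
    next
      case False
      have orth: "\<not> orth U V" using sees orth_sym UD VD by blast
      have c0: "c \<ge> 0"
        using \<open>\<not> nest V U\<close> sees orth point_consistent[OF UD VD _ _ _ y]
          d_nonneg[OF UD, of "\<pi> U y" "\<rho> V U"] d_nonneg[OF VD, of "\<pi> V y" "\<rho> U V"] by fastforce
      have "d V (b V) (\<rho> U V) \<le> c"
        using tuple_consistent[OF UD VD] sees False orth bU c0 by fastforce
      then have yV: "d V (\<pi> V y) (\<rho> U V) > 2 * c"
        using triangle(2)[OF VD, of "\<pi> V y" "b V" "\<rho> U V"] far[OF VR] c0 by linarith
      then have "d U (\<pi> U y) (\<rho> V U) \<le> c"
        using point_consistent[OF UD VD _ _ _ y] sees False orth c0 by fastforce
      then have "d U (\<pi> U y) (b U) > 4 * c"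
        using triangle(3)[OF UD, of "b U" "\<rho> V U" "\<pi> U y"] bU by linarith
      then have "U \<in> R" using R U by auto
      \<comment> \<open>\<open>U\<close> itself need not be maximal, so it is replaced by a maximal
        \<open>W\<close> above it. The points \<open>\<rho> U V\<close> and
        \<open>\<rho> W V\<close> agree up to \<open>c\<close>, and \<open>W\<close> must be before
        \<open>V\<close> because \<open>V\<close> is last.\<close>
      then obtain W where W: "W \<in> M" "nest U W" using below_M by blast
      then have WD: "W \<in> D" using MD by blast
      have "V \<noteq> W" using sees W by blast
      moreover have nVW: "\<not> orth V W" using sees W orth_nest orth_sym UD VD WD by blast
      ultimately have VW: "\<not> nest V W" "sees V W" using M_cases[OF V(1) W(1)] by auto
      moreover have "\<not> before V W" using V(2) W(1) \<open>V \<noteq> W\<close> by metis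
      ultimately have "before W V" using before_total[OF VR, of W] W(1) MR by blast
      then have "d V (\<pi> V y) (\<rho> W V) \<le> c" unfolding before_def by blast
      moreover have "d V (\<rho> U V) (\<rho> W V) \<le> c"
        using rho_consistent[OF UD WD VD W(2)] VW orth orth_sym VD WD by blast
      ultimately show False
        using triangle(2)[OF VD, of "\<pi> V y" "\<rho> U V" "\<rho> W V"] yV by linarith
    qed
  qed
  then show ?thesis using VR by blast
qed

lemma sees_tuple_step:
  assumes UU: "\<U> \<subseteq> D" and V0: "V\<^sub>0 \<in> \<U>"
  shows "\<exists>V\<in>\<U>. (\<forall>U\<in>\<U>. sees V U \<longrightarrow> d U (b U) (\<rho> V U) \<le> 5 * c) \<and>
    (V = V\<^sub>0 \<or> (\<exists>z. realises z V\<^sub>0 \<and> d V (\<pi> V z) (b V) > 4 * c))"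
  \<comment> \<open>The last clause lets a caller exclude a given domain by choosing \<open>V\<^sub>0\<close> suitably.\<close>
proof -
  obtain z where z: "z \<in> Y" "realises z V\<^sub>0" using realises_one UU V0 by blast
  let ?R = "{U \<in> \<U>. d U (\<pi> U z) (b U) > 4 * c}"
  show ?thesis
  proof (cases "?R = {}")
    case False
    with last_relevant_sees_tuple[OF z(1) UU refl] z(2) show ?thesis by blast
  next
    case True
    have "d U (b U) (\<rho> V\<^sub>0 U) \<le> 5 * c" if U: "U \<in> \<U>" "sees V\<^sub>0 U" for U
    proof -
      have UD: "U \<in> D" using U UU by blast
      then have "d U (\<pi> U z) (\<rho> V\<^sub>0 U) \<le> c" using z U unfolding realises_def by blast
      moreover have "d U (\<pi> U z) (b U) \<le> 4 * c" using True U by force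
      ultimately show ?thesis
        using triangle(3)[OF UD, of "b U" "\<rho> V\<^sub>0 U" "\<pi> U z"] by linarith
    qed
    then show ?thesis using V0 by blast
  qed
qed

text \<open>Domains that \<open>V\<close> sees are handled by the invariant \<open>I\<close>: 6c
  there plus \<open>c\<close> for a realising point gives \<open>7 * c\<close>. Domains properly
  below \<open>V\<close> are handled by \<open>tuple_nest\<close>, once minimality of
  \<open>V\<close> has moved \<open>b V\<close> away from every \<open>\<rho> U V\<close>. Downward
  closure keeps this descent inside the given set.\<close>

lemma realising_domain:
  assumes DD: "\<D> \<subseteq> D" "\<D> \<noteq> {}"
    and down: "\<And>U V. V \<in> \<D> \<Longrightarrow> U \<in> D \<Longrightarrow> nest U V \<Longrightarrow> U \<in> \<D>"
  shows "\<exists>V\<in>\<D>. \<forall>U\<in>\<D>. orth V U \<or> (\<forall>y\<in>Y. realises y V \<longrightarrow> d U (\<pi> U y) (b U) \<le> 7 * c)"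
proof -
  \<comment> \<open>Quantifying over all \<open>V'\<close> below \<open>V\<close> keeps the constant fixed when \<open>V\<close> is replaced by a
    properly nested domain, since \<open>\<rho>\<close> is consistent along \<open>\<sqsubseteq>\<close>.\<close>
  define I where "I V \<longleftrightarrow> (\<forall>V'\<in>\<D>. nest V' V \<longrightarrow> (\<forall>U\<in>\<D>. \<not> nest U V \<and> sees V' U \<longrightarrow>
    d U (b U) (\<rho> V' U) \<le> 6 * c))" for V
  have close: "d U (b U) (\<rho> V' U) \<le> 6 * c"
    if "V \<in> \<D>" "U \<in> \<D>" "V' \<in> \<D>" "nest V' V" "sees V' U" "\<not> nest U V"
      and b: "sees V U \<Longrightarrow> d U (b U) (\<rho> V U) \<le> 5 * c" for U V V'
  proof -
    have UD: "U \<in> D" using that DD by blast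
    show ?thesis
      using sees_below_sees[of U V V'] that DD triangle(2)[OF UD, of "b U" "\<rho> V' U" "\<rho> V U"] by fastforce
  qed
  obtain V\<^sub>0 where "V\<^sub>0 \<in> \<D>" using DD by blast
  with sees_tuple_step[OF DD(1)] obtain V\<^sub>1 where
    "V\<^sub>1 \<in> \<D>" "\<forall>U\<in>\<D>. sees V\<^sub>1 U \<longrightarrow> d U (b U) (\<rho> V\<^sub>1 U) \<le> 5 * c" by blast
  then have "V\<^sub>1 \<in> {V \<in> \<D>. I V}" using close unfolding I_def by blast
  moreover have "{V \<in> \<D>. I V} \<subseteq> D" using DD by auto
  ultimately obtain V where V: "V \<in> \<D>" "I V"
    and V_min: "\<And>U. U \<in> \<D> \<Longrightarrow> I U \<Longrightarrow> nest U V \<Longrightarrow> U = V"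
    using nest_minimal[of "{V \<in> \<D>. I V}"] by blast
  have VD: "V \<in> D" using V DD by blast
  \<comment> \<open>If this failed, the search could be restarted among the domains below
    \<open>V\<close>, beginning with \<open>U\<^sub>0\<close>. A point realising
    \<open>U\<^sub>0\<close> is within \<open>3 * c\<close> of \<open>b V\<close>, so the search
    cannot return \<open>V\<close>; it returns a smaller domain satisfying \<open>I\<close>, against
    minimality.\<close>
  have terminal: "d V (b V) (\<rho> U\<^sub>0 V) > 2 * c" if U0: "U\<^sub>0 \<in> D" "nest U\<^sub>0 V" "U\<^sub>0 \<noteq> V" for U\<^sub>0
  proof (rule ccontr)
    assume "\<not> ?thesis"
    then have bV: "d V (b V) (\<rho> U\<^sub>0 V) \<le> 2 * c" by simp
    let ?U = "{U \<in> D. nest U V}"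
    have nV: "sees U\<^sub>0 V" using U0 VD nest_antisym above_not_orth by blast
    have not_V: "d V (\<pi> V z) (b V) \<le> 4 * c" if "realises z U\<^sub>0" for z
    proof -
      have "d V (\<pi> V z) (\<rho> U\<^sub>0 V) \<le> c" using that nV VD unfolding realises_def by blast
      then show ?thesis
        using triangle(2)[OF VD, of "\<pi> V z" "b V" "\<rho> U\<^sub>0 V"] bV d_nonneg[OF VD, of "\<pi> V z" "\<rho> U\<^sub>0 V"] by linarith
    qed
    obtain V' where V': "V' \<in> ?U" "\<forall>U\<in>?U. sees V' U \<longrightarrow> d U (b U) (\<rho> V' U) \<le> 5 * c"
      "V' = U\<^sub>0 \<or> (\<exists>z. realises z U\<^sub>0 \<and> d V' (\<pi> V' z) (b V') > 4 * c)"
      using sees_tuple_step[of ?U U\<^sub>0] U0 by blast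
    then have "V' \<noteq> V" using U0 not_V by fastforce
    have V'D: "V' \<in> \<D>" using V' down V by blast
    have "I V'"
      unfolding I_def
    proof (intro ballI impI)
      fix V'' U
      assume *: "V'' \<in> \<D>" "nest V'' V'" "U \<in> \<D>" "\<not> nest U V' \<and> sees V'' U"
      \<comment> \<open>For \<open>U\<close> below \<open>V\<close> the new search gives 5c, and
        passing from \<open>V'\<close> to \<open>V''\<close> adds one \<open>c\<close>. For the
        other \<open>U\<close> the bound is inherited from \<open>I V\<close> without loss.\<close>
      show "d U (b U) (\<rho> V'' U) \<le> 6 * c"
      proof (cases "nest U V")
        case True
        then show ?thesis using close[of V' U V''] * V'D V' DD by blast
      next
        case False
        moreover have "nest V'' V" using nest_trans[of V'' V' V] * V' DD VD by blast
        ultimately show ?thesis using V(2) * unfolding I_def by blast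
      qed
    qed
    then show False using V_min V' V'D \<open>V' \<noteq> V\<close> by blast
  qed
  have "d U (\<pi> U y) (b U) \<le> 7 * c"
    if U: "U \<in> \<D>" "\<not> orth V U" and y: "y \<in> Y" "realises y V" for U y
  proof -
    have UD: "U \<in> D" using U DD by blast
    have yV: "d V (\<pi> V y) (b V) \<le> c" using y unfolding realises_def by blast
    then have c0: "c \<ge> 0" using d_nonneg[OF VD, of "\<pi> V y" "b V"] by linarith
    consider "U = V" | "nest U V" "U \<noteq> V" | "\<not> nest U V" by blast
    then show ?thesis
    proof cases
      case 1
      then show ?thesis using yV c0 by simp
    next
      case 2
      then have "d U (\<pi> U y) (b U) \<le> c"
        using tuple_nest[OF UD VD _ _ y(1)] terminal[OF UD] yV by force
      then show ?thesis using c0 by simp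
    next
      case 3
      then have "d U (b U) (\<rho> V U) \<le> 6 * c"
        using V U nest_refl[OF VD] unfolding I_def by blast
      moreover have "d U (\<pi> U y) (\<rho> V U) \<le> c" using y U UD 3 unfolding realises_def by blast
      ultimately show ?thesis using triangle(2)[OF UD, of "\<pi> U y" "b U" "\<rho> V U"] by linarith
    qed
  qed
  then show ?thesis using V(1) by blast
qed

text \<open>A largest adapted family exists by \<open>orth_card\<close>. The domains orthogonal to
  all its members are closed downwards, so if there were any, \<open>realising_domain\<close> would
  supply a further member. Hence every domain falls under the second alternative of
  \<open>adapted\<close>.\<close>

theorem realisation: "\<exists>y\<in>Y. \<forall>U\<in>D. d U (\<pi> U y) (b U) \<le> 7 * c"
proof -
  define adapted where "adapted A \<longleftrightarrow> A \<subseteq> D \<and> pairwise orth A \<and>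
    (\<forall>U\<in>D. (\<forall>V\<in>A. orth V U) \<or>
      (\<forall>y\<in>Y. (\<forall>V\<in>A. realises y V) \<longrightarrow> d U (\<pi> U y) (b U) \<le> 7 * c))" for A
  have "adapted {}" by (simp add: adapted_def)
  moreover have "\<forall>A. adapted A \<longrightarrow> card A < Suc N"
    using orth_card unfolding adapted_def by (simp add: less_Suc_eq_le)
  ultimately obtain A where A: "adapted A" "\<And>B. adapted B \<Longrightarrow> card B \<le> card A"
    using ex_has_greatest_nat[of adapted "{}" card "Suc N"] by auto
  have AD: "A \<subseteq> D" and Aorth: "pairwise orth A" and finA: "finite A"
    using A(1) orth_card unfolding adapted_def by auto
  let ?D = "{U \<in> D. \<forall>V\<in>A. orth V U}"
  have "?D = {}"
  proof (rule ccontr)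
    assume ne: "?D \<noteq> {}"
    have "U \<in> ?D" if "V \<in> ?D" "U \<in> D" "nest U V" for U V
      using that AD orth_nest orth_sym by blast
    then obtain V where V: "V \<in> ?D"
      "\<forall>U\<in>?D. orth V U \<or> (\<forall>y\<in>Y. realises y V \<longrightarrow> d U (\<pi> U y) (b U) \<le> 7 * c)"
      using realising_domain[OF _ ne] by blast
    have "V \<notin> A" using V orth_not_nest nest_refl by blast
    have "pairwise orth (insert V A)"
      using Aorth V AD orth_sym by (auto simp: pairwise_insert)
    then have "adapted (insert V A)" using A(1) V unfolding adapted_def by blast
    then show False using A(2) \<open>V \<notin> A\<close> finA by fastforce
  qed
  moreover obtain y where "y \<in> Y" "\<forall>V\<in>A. realises y V"
    using realises_ex[OF AD Aorth] by blast
  ultimately show ?thesis using A(1) unfolding adapted_def by blast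
qed

end

section \<open>Quasiconvex sets in hyperbolic spaces\<close>

lemma mdist_triangle4:
  assumes "p \<in> mspace m" "q \<in> mspace m" "s \<in> mspace m"
  shows "mdist m p s \<le> mdist m p q + mdist m q s" "mdist m p s \<le> mdist m p q + mdist m s q"
    "mdist m p s \<le> mdist m q p + mdist m q s" "mdist m p s \<le> mdist m q p + mdist m s q"
  using mdist_triangle[OF assms] mdist_commute[of m] by metis+

lemma geodesic_ends:
  assumes "geodesic_between m x y \<gamma>"
  shows "x \<in> \<gamma>" "y \<in> \<gamma>" "\<gamma> \<subseteq> mspace m"
  using assms unfolding geodesic_between_def by auto

lemma geodesic_split:
  assumes "geodesic_between m x y \<gamma>" "p \<in> \<gamma>"
  shows "mdist m x p + mdist m p y = mdist m x y"
proof -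
  obtain c l where l: "0 \<le> l" "c 0 = x" "c l = y"
    and c: "\<And>s t. s \<in> {0..l} \<Longrightarrow> t \<in> {0..l} \<Longrightarrow> mdist m (c s) (c t) = \<bar>s - t\<bar>"
    and \<gamma>: "\<gamma> = c ` {0..l}"
    using assms(1) unfolding geodesic_between_def by blast
  obtain t where "t \<in> {0..l}" "p = c t" using assms(2) \<gamma> by blast
  then show ?thesis using l c[of 0 t] c[of t l] c[of 0 l] by auto
qed

lemma geodesic_point:
  assumes "geodesic_between m x y \<gamma>" "0 \<le> t" "t \<le> mdist m x y"
  shows "\<exists>p\<in>\<gamma>. mdist m x p = t"
proof -
  obtain c l where l: "0 \<le> l" "c 0 = x" "c l = y"
    and c: "\<And>s t. s \<in> {0..l} \<Longrightarrow> t \<in> {0..l} \<Longrightarrow> mdist m (c s) (c t) = \<bar>s - t\<bar>"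
    and \<gamma>: "\<gamma> = c ` {0..l}"
    using assms(1) unfolding geodesic_between_def by blast
  have "t \<le> l" using assms(3) l c[of 0 l] by auto
  then have "c t \<in> \<gamma>" "mdist m x (c t) = t" using assms(2) l c[of 0 t] \<gamma> by auto
  then show ?thesis by blast
qed

lemma geodesic_isometry_image:
  assumes f: "isometry_onto m n f" and \<gamma>: "geodesic_between m x y \<gamma>"
  shows "geodesic_between n (f x) (f y) (f ` \<gamma>)"
proof -
  obtain c l where c: "0 \<le> l" "c 0 = x" "c l = y" "c ` {0..l} \<subseteq> mspace m"
    "\<forall>s\<in>{0..l}. \<forall>t\<in>{0..l}. mdist m (c s) (c t) = \<bar>s - t\<bar>" "\<gamma> = c ` {0..l}"
    using \<gamma> unfolding geodesic_between_def by blast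
  show ?thesis
    unfolding geodesic_between_def
  proof (intro exI conjI)
    show "0 \<le> l" "(f \<circ> c) 0 = f x" "(f \<circ> c) l = f y" "f ` \<gamma> = (f \<circ> c) ` {0..l}"
      using c by (auto simp: image_comp)
    show "(f \<circ> c) ` {0..l} \<subseteq> mspace n"
      using image_mono[OF c(4), of f] f unfolding isometry_onto_def by (simp add: image_comp)
    show "\<forall>s\<in>{0..l}. \<forall>t\<in>{0..l}. mdist n ((f \<circ> c) s) ((f \<circ> c) t) = \<bar>s - t\<bar>"
      using c f unfolding isometry_onto_def by (simp add: image_subset_iff)
  qed
qed

text \<open>A point \<open>w\<close> of the geodesic is taken too close to \<open>x\<close> to be
  near \<open>Q\<close>. Slimness then puts it next to the side from \<open>x\<close> to
  \<open>g\<close>, whose end is \<open>g\<close>. Nearest points need not exist, hence the slack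
  1.\<close>

lemma geodesic_near_gate:
  assumes \<delta>: "hyperbolic \<delta> m" "0 \<le> \<delta>" and geo: "geodesic_space m"
    and Q: "quasiconvex m k Q" "Q \<subseteq> mspace m" "0 \<le> k"
    and x: "x \<in> mspace m" and g: "g \<in> Q" "\<And>q. q \<in> Q \<Longrightarrow> mdist m x g \<le> mdist m x q + 1"
    and u: "u \<in> Q" and \<gamma>: "geodesic_between m x u \<gamma>"
  shows "\<exists>w\<in>\<gamma>. mdist m w g \<le> 3 * \<delta> + k + 2"
proof -
  have gM: "g \<in> mspace m" and uM: "u \<in> mspace m" using g u Q by auto
  obtain \<alpha> \<beta> where \<alpha>: "geodesic_between m x g \<alpha>" and \<beta>: "geodesic_between m g u \<beta>"
    using geo x gM uM unfolding geodesic_space_def by meson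
  \<comment> \<open>If \<open>t\<close> is positive, a point of \<open>Q\<close> within \<delta> + k
    of \<open>w\<close> would be closer to \<open>x\<close> than \<open>g\<close> by at least 2,
    more than the slack 1 permits. The truncation at 0 covers \<open>x\<close> itself being close to
    \<open>g\<close>.\<close>
  define t where "t = max 0 (mdist m x g - 2 - k - \<delta>)"
  have "t \<le> mdist m x u" using g(2)[OF u] \<delta> Q by (simp add: t_def)
  then obtain w where w: "w \<in> \<gamma>" "mdist m x w = t"
    using geodesic_point[OF \<gamma>, of t] by (auto simp: t_def)
  have wM: "w \<in> mspace m" using w geodesic_ends(3)[OF \<gamma>] by blast
  have "w \<in> nbhd m \<delta> (\<alpha> \<union> \<beta>)" using \<delta> \<alpha> \<beta> \<gamma> w unfolding hyperbolic_def by blast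
  then obtain a where a: "a \<in> \<alpha> \<or> a \<in> \<beta>" "mdist m w a \<le> \<delta>" unfolding nbhd_def by blast
  have aM: "a \<in> mspace m" using a geodesic_ends(3)[OF \<alpha>] geodesic_ends(3)[OF \<beta>] by blast
  have "mdist m w g \<le> 3 * \<delta> + k + 2"
  proof (cases "a \<in> \<alpha>")
    case True
    have "mdist m x a + mdist m a g = mdist m x g" using geodesic_split[OF \<alpha> True] .
    moreover have "t \<le> mdist m x a + \<delta>" using mdist_triangle4(2)[OF x aM wM] w a by linarith
    moreover have "mdist m w g \<le> \<delta> + mdist m a g" using mdist_triangle4(1)[OF wM aM gM] a by linarith
    ultimately show ?thesis using \<delta> Q unfolding t_def by linarith
  next
    case False
    then have "a \<in> nbhd m k Q" using a Q g u \<beta> unfolding quasiconvex_def by blast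
    then obtain q where q: "q \<in> Q" "mdist m a q \<le> k" unfolding nbhd_def by blast
    then have qM: "q \<in> mspace m" using Q by auto
    have "mdist m x g \<le> t + \<delta> + k + 1"
      using g(2)[OF q(1)] mdist_triangle4(1)[OF x aM qM] mdist_triangle4(1)[OF x wM aM] a q w by linarith
    then have "t = 0" "mdist m x g \<le> 2 + k + \<delta>" using \<delta> Q unfolding t_def by (auto simp: max_def split: if_splits)
    then show ?thesis using mdist_triangle4(3)[OF wM x gM] w \<delta> by linarith
  qed
  then show ?thesis using w by blast
qed

text \<open>Twice the gate error of \<open>geodesic_near_gate\<close>, plus errors from two slim triangles, from
  quasiconvexity and from the distance \<open>r\<close> between the sets.\<close>

definition helly_const :: "real \<Rightarrow> real \<Rightarrow> real \<Rightarrow> real" where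
  "helly_const \<delta> k r = 2 * (3 * \<delta> + k + 2) + 4 * \<delta> + k + r"

text \<open>The point near \<open>g\<^sub>1\<close> on the geodesic to \<open>u\<close> is pushed
  through the triangles on \<open>x\<close>, \<open>u\<close>, \<open>v\<close> and on
  \<open>x\<close>, \<open>g\<^sub>2\<close>, \<open>v\<close>. The only side not near
  \<open>Q\<^sub>2\<close> is the one from \<open>x\<close> to \<open>g\<^sub>2\<close>; there
  \<open>le\<close> forces the point to its end \<open>g\<^sub>2\<close>. This comparison is why the
  farthest set is the right one to choose from.\<close>

lemma farther_gate_near:
  assumes \<delta>: "hyperbolic \<delta> m" "0 \<le> \<delta>" and geo: "geodesic_space m"
    and Q\<^sub>1: "quasiconvex m k Q\<^sub>1" "Q\<^sub>1 \<subseteq> mspace m"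
    and Q\<^sub>2: "quasiconvex m k Q\<^sub>2" "Q\<^sub>2 \<subseteq> mspace m" and k: "0 \<le> k"
    and x: "x \<in> mspace m"
    and g\<^sub>1: "g\<^sub>1 \<in> Q\<^sub>1" "\<And>q. q \<in> Q\<^sub>1 \<Longrightarrow> mdist m x g\<^sub>1 \<le> mdist m x q + 1"
    and g\<^sub>2: "g\<^sub>2 \<in> Q\<^sub>2" "\<And>q. q \<in> Q\<^sub>2 \<Longrightarrow> mdist m x g\<^sub>2 \<le> mdist m x q + 1"
    and le: "mdist m x g\<^sub>2 \<le> mdist m x g\<^sub>1"
    and uv: "u \<in> Q\<^sub>1" "v \<in> Q\<^sub>2" "mdist m u v \<le> r"
  shows "\<exists>q\<in>Q\<^sub>2. mdist m g\<^sub>1 q \<le> helly_const \<delta> k r"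
proof -
  let ?c = "3 * \<delta> + k + 2"
  have r: "0 \<le> r" using uv(3) mdist_nonneg[of m u v] by linarith
  have M: "g\<^sub>1 \<in> mspace m" "g\<^sub>2 \<in> mspace m" "u \<in> mspace m" "v \<in> mspace m"
    using g\<^sub>1 g\<^sub>2 uv Q\<^sub>1 Q\<^sub>2 by auto
  obtain \<alpha> \<beta> \<gamma> \<eta> \<zeta> where \<alpha>: "geodesic_between m x u \<alpha>" and \<beta>: "geodesic_between m x v \<beta>"
    and \<gamma>: "geodesic_between m v u \<gamma>" and \<eta>: "geodesic_between m x g\<^sub>2 \<eta>"
    and \<zeta>: "geodesic_between m g\<^sub>2 v \<zeta>"
    using geo x M unfolding geodesic_space_def by meson
  obtain w where w: "w \<in> \<alpha>" "mdist m w g\<^sub>1 \<le> ?c"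
    using geodesic_near_gate[OF \<delta> geo Q\<^sub>1 k x g\<^sub>1 uv(1) \<alpha>] by blast
  have wM: "w \<in> mspace m" using w geodesic_ends(3)[OF \<alpha>] by blast
  have "w \<in> nbhd m \<delta> (\<beta> \<union> \<gamma>)" using \<delta> \<alpha> \<beta> \<gamma> w unfolding hyperbolic_def by blast
  then obtain a where a: "a \<in> \<beta> \<or> a \<in> \<gamma>" "mdist m w a \<le> \<delta>" unfolding nbhd_def by blast
  have aM: "a \<in> mspace m" using a geodesic_ends(3)[OF \<beta>] geodesic_ends(3)[OF \<gamma>] by blast
  have ga: "mdist m g\<^sub>1 a \<le> ?c + \<delta>" using mdist_triangle4(3)[OF M(1) wM aM] w a by linarith
  show ?thesis
  proof (cases "a \<in> \<beta>")
    case False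
    then have "mdist m v a + mdist m a u = mdist m v u" using a geodesic_split[OF \<gamma>] by blast
    then have "mdist m v a \<le> r"
      using uv(3) mdist_commute[of m u v] mdist_nonneg[of m a u] by linarith
    then have "mdist m g\<^sub>1 v \<le> ?c + \<delta> + r" using mdist_triangle4(2)[OF M(1) aM M(4)] ga by linarith
    then show ?thesis using uv \<delta> k r unfolding helly_const_def by (intro bexI[of _ v]) auto
  next
    case True
    have "a \<in> nbhd m \<delta> (\<eta> \<union> \<zeta>)" using \<delta> \<eta> \<zeta> \<beta> True unfolding hyperbolic_def by blast
    then obtain p where p: "p \<in> \<eta> \<or> p \<in> \<zeta>" "mdist m a p \<le> \<delta>" unfolding nbhd_def by blast
    have pM: "p \<in> mspace m" using p geodesic_ends(3)[OF \<eta>] geodesic_ends(3)[OF \<zeta>] by blast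
    have gp: "mdist m g\<^sub>1 p \<le> ?c + 2 * \<delta>" using mdist_triangle4(1)[OF M(1) aM pM] ga p by linarith
    show ?thesis
    proof (cases "p \<in> \<eta>")
      case True
      have "mdist m x p + mdist m p g\<^sub>2 = mdist m x g\<^sub>2" using geodesic_split[OF \<eta> True] .
      moreover have "mdist m x g\<^sub>1 \<le> mdist m x p + (?c + 2 * \<delta>)"
        using mdist_triangle4(2)[OF x pM M(1)] gp by linarith
      ultimately have "mdist m p g\<^sub>2 \<le> ?c + 2 * \<delta>" using le by linarith
      then have "mdist m g\<^sub>1 g\<^sub>2 \<le> (?c + 2 * \<delta>) + (?c + 2 * \<delta>)"
        using mdist_triangle4(1)[OF M(1) pM M(2)] gp by linarith
      then show ?thesis using g\<^sub>2 \<delta> k r unfolding helly_const_def by (intro bexI[of _ g\<^sub>2]) auto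
    next
      case False
      then have "p \<in> nbhd m k Q\<^sub>2" using p Q\<^sub>2 g\<^sub>2 uv \<zeta> unfolding quasiconvex_def by blast
      then obtain q where q: "q \<in> Q\<^sub>2" "mdist m p q \<le> k" unfolding nbhd_def by blast
      then have "mdist m g\<^sub>1 q \<le> ?c + 2 * \<delta> + k"
        using mdist_triangle4(1)[OF M(1) pM, of q] gp Q\<^sub>2 by fastforce
      then show ?thesis using q \<delta> k r unfolding helly_const_def by (intro bexI[of _ q]) auto
    qed
  qed
qed

section \<open>Point-valued projections\<close>

lemma sdist_le:
  assumes "\<And>p q. 0 \<le> d p q" "a \<in> A" "b \<in> B"
  shows "sdist d A B \<le> d a b"
proof -
  have "bdd_below ((\<lambda>(a, b). d a b) ` (A \<times> B))" using assms(1) by (auto intro!: bdd_belowI[of _ 0])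
  from cINF_lower[OF this, of "(a, b)"] show ?thesis using assms(2,3) by (simp add: sdist_def)
qed

lemma sdist_attained:
  assumes "\<And>p q. 0 \<le> d p q" "A \<noteq> {}" "B \<noteq> {}" "sdist d A B < r"
  shows "\<exists>a\<in>A. \<exists>b\<in>B. d a b < r"
proof -
  have "bdd_below ((\<lambda>(a, b). d a b) ` (A \<times> B))" using assms(1) by (auto intro!: bdd_belowI[of _ 0])
  then show ?thesis using assms(2-4) cINF_less_iff[of "A \<times> B" "\<lambda>(a, b). d a b" r] unfolding sdist_def by auto
qed

definition rep :: "'a set \<Rightarrow> 'a" where
  "rep A = (SOME a. a \<in> A)"

lemma rep_in: "A \<noteq> {} \<Longrightarrow> rep A \<in> A"
  unfolding rep_def by (simp add: some_in_eq)

lemma coarse_point_rep: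
  assumes "coarse_point m r A"
  shows "rep A \<in> A" "rep A \<in> mspace m" "a \<in> A \<Longrightarrow> mdist m a (rep A) \<le> r"
  using assms rep_in[of A] unfolding coarse_point_def mdiam_le_def by auto

text \<open>With both diameters at most \<open>E\<close>, a bound \<open>E\<close> between sets
  becomes \<open>3 * E\<close> between representatives; this is the origin of the thresholds
  \<open>3 * E\<close> below.\<close>

lemma rep_dist_le:
  assumes A: "coarse_point m r A" and B: "coarse_point m r B" and le: "sdist (mdist m) A B \<le> s"
  shows "mdist m (rep A) (rep B) \<le> s + 2 * r"
proof (rule field_le_epsilon)
  fix \<epsilon> :: real
  assume "0 < \<epsilon>"
  moreover have "A \<noteq> {}" "B \<noteq> {}" using A B unfolding coarse_point_def by auto
  ultimately obtain a b where ab: "a \<in> A" "b \<in> B" "mdist m a b < s + \<epsilon>"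
    using sdist_attained[of "mdist m" A B "s + \<epsilon>"] le by auto
  then have M: "a \<in> mspace m" "b \<in> mspace m" using A B unfolding coarse_point_def by auto
  show "mdist m (rep A) (rep B) \<le> s + 2 * r + \<epsilon>"
    using mdist_triangle4(3)[OF coarse_point_rep(2)[OF A] M(1) coarse_point_rep(2)[OF B]]
      mdist_triangle4(1)[OF M coarse_point_rep(2)[OF B]]
      coarse_point_rep(3)[OF A ab(1)] coarse_point_rep(3)[OF B ab(2)] ab(3) by linarith
qed

context hhg
begin

definition pt :: "'s \<Rightarrow> 'g \<Rightarrow> 'p" where
  "pt U x = rep (proj X U x)"

definition rpt :: "'s \<Rightarrow> 's \<Rightarrow> 'p" where
  "rpt V U = rep (rho X V U)"

definition rmap :: "'s \<Rightarrow> 's \<Rightarrow> 'p \<Rightarrow> 'p" where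
  "rmap V U p = rep (rho_map X V U p)"

text \<open>Moving points outside \<open>\<C>U\<close> to a fixed point of \<open>\<C>U\<close> makes the triangle inequality
  unconditional.\<close>

definition retract :: "'s \<Rightarrow> 'p \<Rightarrow> 'p" where
  "retract U p = (if p \<in> mspace (space_of X U) then p else rep (mspace (space_of X U)))"

definition dd :: "'s \<Rightarrow> 'p \<Rightarrow> 'p \<Rightarrow> real" where
  "dd U p q = mdist (space_of X U) (retract U p) (retract U q)"

lemma dd_eq:
  "p \<in> mspace (space_of X U) \<Longrightarrow> q \<in> mspace (space_of X U) \<Longrightarrow> dd U p q = mdist (space_of X U) p q"
  by (simp add: dd_def retract_def)

lemma dd_sym: "dd U p q = dd U q p"
  by (simp add: dd_def mdist_commute)

lemma dd_nonneg: "0 \<le> dd U p q"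
  by (simp add: dd_def)

lemma pt_in: "U \<in> domains X \<Longrightarrow> x \<in> carrier G \<Longrightarrow> pt U x \<in> mspace (space_of X U)"
  using coarse_point_rep(2)[OF proj_coarse] by (simp add: pt_def)

lemma retract_in: "U \<in> domains X \<Longrightarrow> retract U p \<in> mspace (space_of X U)"
  using pt_in[OF _ one_closed, of U] rep_in[of "mspace (space_of X U)"]
  unfolding retract_def by (metis empty_iff)

lemma dd_triangle:
  assumes "U \<in> domains X"
  shows "dd U p s \<le> dd U p q + dd U q s" "dd U p s \<le> dd U p q + dd U s q"
    "dd U p s \<le> dd U q p + dd U q s" "dd U p s \<le> dd U q p + dd U s q"
  unfolding dd_def by (rule mdist_triangle4[OF retract_in[OF assms] retract_in[OF assms] retract_in[OF assms]])+

lemma dd_self: "U \<in> domains X \<Longrightarrow> dd U p p = 0"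
  using retract_in unfolding dd_def by simp

lemma domain_ex: "\<exists>U. U \<in> domains X"
  using nest_max by blast

lemma E_nonneg: "0 \<le> E"
proof -
  obtain U where "U \<in> domains X" using domain_ex by blast
  then have "coarse_point (space_of X U) E (proj X U \<one>)" using proj_coarse by blast
  from coarse_point_rep(3)[OF this coarse_point_rep(1)[OF this]] show ?thesis
    by (rule order_trans[OF mdist_nonneg])
qed

lemma pt_dist:
  assumes "U \<in> domains X" "x \<in> carrier G" "y \<in> carrier G" "dproj X U x y \<le> s"
  shows "dd U (pt U x) (pt U y) \<le> s + 2 * E"
  using rep_dist_le[OF proj_coarse[OF assms(1,2)] proj_coarse[OF assms(1,3)], of s] assms(4)
    dd_eq[OF pt_in[OF assms(1,2)] pt_in[OF assms(1,3)]]
  unfolding dproj_def dist_in_def pt_def by linarith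

lemma rho_coarse:
  assumes "U \<in> domains X" "V \<in> domains X" "\<not> nest X U V" "\<not> orth X V U"
  shows "coarse_point (space_of X U) E (rho X V U)"
proof (cases "nest X V U")
  case True
  then show ?thesis using rho_nest[of V U] assms unfolding proper_nest_def by blast
next
  case False
  then show ?thesis using rho_transverse[of V U] assms unfolding transverse_def by blast
qed

lemma rpt_in:
  assumes "U \<in> domains X" "V \<in> domains X" "\<not> nest X U V" "\<not> orth X V U"
  shows "rpt V U \<in> mspace (space_of X U)"
  using coarse_point_rep(2)[OF rho_coarse[OF assms]] by (simp add: rpt_def)

lemma orth_commute: "U \<in> domains X \<Longrightarrow> V \<in> domains X \<Longrightarrow> orth X U V \<Longrightarrow> orth X V U"
  using orth_rel(1) unfolding symp_on_def by blast

lemma nest_refl: "U \<in> domains X \<Longrightarrow> nest X U U"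
  using nest_order(1) unfolding reflp_on_def by blast

lemma nest_antisym:
  "U \<in> domains X \<Longrightarrow> V \<in> domains X \<Longrightarrow> nest X U V \<Longrightarrow> nest X V U \<Longrightarrow> U = V"
  using nest_order(2) unfolding antisymp_on_def by blast

lemma nest_trans:
  "U \<in> domains X \<Longrightarrow> V \<in> domains X \<Longrightarrow> W \<in> domains X \<Longrightarrow> nest X U V \<Longrightarrow> nest X V W \<Longrightarrow> nest X U W"
  using nest_order(3) unfolding transp_on_def by blast

section \<open>Consistency and bounded geodesic image for representatives\<close>

lemma pt_rho_dist:
  assumes "U \<in> domains X" "V \<in> domains X" "\<not> nest X U V" "\<not> orth X V U" "x \<in> carrier G"
    and "dist_in X U (proj X U x) (rho X V U) \<le> E"
  shows "dd U (pt U x) (rpt V U) \<le> 3 * E"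
  using rep_dist_le[OF proj_coarse[OF assms(1,5)] rho_coarse[OF assms(1-4)], of E] assms(6)
    dd_eq[OF pt_in[OF assms(1,5)] rpt_in[OF assms(1-4)]]
  unfolding dist_in_def pt_def rpt_def by linarith

lemma pt_consistent:
  assumes "U \<in> domains X" "V \<in> domains X" "\<not> nest X U V" "\<not> nest X V U" "\<not> orth X U V"
    and "x \<in> carrier G"
  shows "dd U (pt U x) (rpt V U) \<le> 3 * E \<or> dd V (pt V x) (rpt U V) \<le> 3 * E"
proof -
  have "\<not> orth X V U" using orth_commute assms by blast
  moreover have "dist_in X U (proj X U x) (rho X V U) \<le> E \<or> dist_in X V (proj X V x) (rho X U V) \<le> E"
    using consistency_transverse[OF assms(1,2) _ assms(6)] assms(3-5)
    unfolding transverse_def by (simp add: min_le_iff_disj)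
  ultimately show ?thesis using pt_rho_dist assms by blast
qed

lemma rmap_in:
  assumes "U \<in> domains X" "V \<in> domains X" "proper_nest X U V" "p \<in> mspace (space_of X V)"
  shows "rmap V U p \<in> mspace (space_of X U)"
  using coarse_point_rep(2)[OF rho_map_nest[OF assms]] by (simp add: rmap_def)

lemma proper_nest_sees:
  assumes "U \<in> domains X" "V \<in> domains X" "proper_nest X U V"
  shows "\<not> nest X V U" "\<not> orth X U V"
  using assms nest_antisym orth_incomparable unfolding proper_nest_def by blast+

lemma pt_consistent_nest:
  assumes UV: "U \<in> domains X" "V \<in> domains X" "proper_nest X U V" and x: "x \<in> carrier G"
    and far: "dd V (pt V x) (rpt U V) > 3 * E"
  shows "dd U (pt U x) (rmap V U (pt V x)) \<le> E"
proof -
  have "\<not> dist_in X V (proj X V x) (rho X U V) \<le> E"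
    using pt_rho_dist[OF UV(2,1) _ _ x] proper_nest_sees[OF UV] far by force
  then have "mdiam_le (space_of X U) (proj X U x \<union> (\<Union>p\<in>proj X V x. rho_map X V U p)) E"
    using consistency_nest[OF UV x] by blast
  moreover have "pt U x \<in> proj X U x" "pt V x \<in> proj X V x"
    "rmap V U (pt V x) \<in> rho_map X V U (pt V x)"
    using coarse_point_rep(1)[OF proj_coarse] coarse_point_rep(1)[OF rho_map_nest[OF UV]] UV x pt_in
    unfolding pt_def rmap_def by blast+
  ultimately have "mdist (space_of X U) (pt U x) (rmap V U (pt V x)) \<le> E"
    unfolding mdiam_le_def by blast
  then show ?thesis using pt_in[OF UV(1) x] rmap_in[OF UV pt_in[OF UV(2) x]] by (simp add: dd_eq)
qed

lemma rmap_geodesic: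
  assumes UV: "U \<in> domains X" "V \<in> domains X" "proper_nest X U V"
    and \<gamma>: "geodesic_between (space_of X V) p q \<gamma>"
    and far: "\<And>w. w \<in> \<gamma> \<Longrightarrow> dd V w (rpt U V) > 3 * E"
  shows "dd U (rmap V U p) (rmap V U q) \<le> E"
proof -
  note cp = rho_coarse[OF UV(2,1) proper_nest_sees[OF UV]]
  have "w \<notin> nbhd (space_of X V) E (rho X U V)" if w: "w \<in> \<gamma>" for w
  proof
    assume "w \<in> nbhd (space_of X V) E (rho X U V)"
    then obtain a where a: "a \<in> rho X U V" "mdist (space_of X V) w a \<le> E" "w \<in> mspace (space_of X V)"
      unfolding nbhd_def by blast
    then have aM: "a \<in> mspace (space_of X V)" using cp unfolding coarse_point_def by blast
    have "dd V w a \<le> E" "dd V a (rpt U V) \<le> E"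
      using a aM coarse_point_rep[OF cp] by (auto simp: dd_eq rpt_def)
    then show False using far[OF w] dd_triangle(1)[OF UV(2), of w "rpt U V" a] E_nonneg by linarith
  qed
  then have *: "mdiam_le (space_of X U) (\<Union>p\<in>\<gamma>. rho_map X V U p) E"
    using bounded_geodesic_image[OF UV \<gamma>] by blast
  have pq: "p \<in> \<gamma>" "q \<in> \<gamma>" "p \<in> mspace (space_of X V)" "q \<in> mspace (space_of X V)"
    using geodesic_ends[OF \<gamma>] by auto
  have "rmap V U p \<in> rho_map X V U p" "rmap V U q \<in> rho_map X V U q"
    using coarse_point_rep(1)[OF rho_map_nest[OF UV]] pq unfolding rmap_def by auto
  then have "mdist (space_of X U) (rmap V U p) (rmap V U q) \<le> E"
    using * pq(1,2) unfolding mdiam_le_def by blast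
  then show ?thesis using pq rmap_in[OF UV] by (simp add: dd_eq)
qed

lemma geodesic_ex:
  assumes "U \<in> domains X" "p \<in> mspace (space_of X U)" "q \<in> mspace (space_of X U)"
  shows "\<exists>\<gamma>. geodesic_between (space_of X U) p q \<gamma>"
  using spaces[OF assms(1)] assms(2,3) unfolding geodesic_space_def by blast

text \<open>Consistency identifies \<open>pt U x\<close> with the image of \<open>pt V x\<close>,
  and bounded geodesic image carries that image along \<open>\<gamma>\<close> to the image of
  \<open>p\<close>.\<close>

lemma pt_near_rmap:
  assumes UV: "U \<in> domains X" "V \<in> domains X" "proper_nest X U V" and x: "x \<in> carrier G"
    and \<gamma>: "geodesic_between (space_of X V) (pt V x) p \<gamma>"
    and far: "\<And>w. w \<in> \<gamma> \<Longrightarrow> dd V w (rpt U V) > 3 * E"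
  shows "dd U (pt U x) (rmap V U p) \<le> 6 * E"
proof -
  have "dd U (pt U x) (rmap V U (pt V x)) \<le> E"
    using pt_consistent_nest[OF UV x] far geodesic_ends(1)[OF \<gamma>] by blast
  then show ?thesis
    using rmap_geodesic[OF UV \<gamma> far] E_nonneg
      dd_triangle(1)[OF UV(1), of "pt U x" "rmap V U p" "rmap V U (pt V x)"] by linarith
qed

text \<open>A geodesic ending at \<open>p\<close> that is shorter than the distance from
  \<open>p\<close> to \<open>rpt U V\<close> by more than \<open>3 * E\<close> cannot come near
  \<open>rpt U V\<close>.\<close>

lemma pt_near_rmap_short:
  assumes UV: "U \<in> domains X" "V \<in> domains X" "proper_nest X U V" and x: "x \<in> carrier G"
    and p: "p \<in> mspace (space_of X V)"
    and far: "dd V p (rpt U V) > dd V (pt V x) p + 3 * E"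
  shows "dd U (pt U x) (rmap V U p) \<le> 6 * E"
proof -
  obtain \<gamma> where \<gamma>: "geodesic_between (space_of X V) (pt V x) p \<gamma>"
    using geodesic_ex pt_in UV x p by blast
  show ?thesis
  proof (rule pt_near_rmap[OF UV x \<gamma>])
    fix w assume w: "w \<in> \<gamma>"
    then have "w \<in> mspace (space_of X V)" using geodesic_ends(3)[OF \<gamma>] by blast
    then have "dd V (pt V x) w + dd V w p = dd V (pt V x) p"
      using geodesic_split[OF \<gamma> w] pt_in[OF UV(2) x] p by (simp add: dd_eq)
    then show "dd V w (rpt U V) > 3 * E"
      using far dd_triangle(3)[OF UV(2), of p "rpt U V" w] dd_nonneg[of V "pt V x" w] by linarith
  qed
qed

lemma rpt_consistent:
  assumes D: "U \<in> domains X" "V \<in> domains X" "W \<in> domains X"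
    and UV: "nest X U V" and W: "\<not> nest X W V" "\<not> orth X V W" "\<not> orth X U W"
  shows "dd W (rpt U W) (rpt V W) \<le> 3 * E"
proof -
  have nWU: "\<not> nest X W U" using W UV nest_trans D by blast
  have "\<not> orth X W U" using W(3) orth_commute D by blast
  then have "proper_nest X V W \<or> transverse X V W \<and> \<not> orth X W U"
    using W nest_refl D unfolding proper_nest_def transverse_def by blast
  then have "dist_in X W (rho X U W) (rho X V W) \<le> E" using consistency_rho[OF D UV] by blast
  then show ?thesis
    using rep_dist_le[OF rho_coarse[OF D(3,1) nWU W(3)] rho_coarse[OF D(3,2) W(1,2)], of E]
      dd_eq[OF rpt_in[OF D(3,1) nWU W(3)] rpt_in[OF D(3,2) W(1,2)]]
    unfolding dist_in_def rpt_def by linarith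
qed

text \<open>Partial realisation wants values in the image of the projection. Coarse surjectivity
  moves \<open>p V\<close> there at cost \<open>E\<close>; realisation and the choice of
  representative cost \<open>E\<close> each.\<close>

lemma pt_realise:
  assumes A: "A \<subseteq> domains X" "pairwise (orth X) A"
    and p: "\<And>V. V \<in> A \<Longrightarrow> p V \<in> mspace (space_of X V)"
  shows "\<exists>y\<in>carrier G. \<forall>V\<in>A. dd V (pt V y) (p V) \<le> 3 * E \<and>
    (\<forall>U\<in>domains X. \<not> nest X U V \<and> \<not> orth X V U \<longrightarrow> dd U (pt U y) (rpt V U) \<le> 3 * E)"
proof -
  have "\<exists>p'. p' \<in> proj_set X V (carrier G) \<and> mdist (space_of X V) (p V) p' \<le> E" if "V \<in> A" for V
    using proj_onto[of V] p[OF that] A that unfolding nbhd_def by blast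
  then obtain p' where p': "\<And>V. V \<in> A \<Longrightarrow> p' V \<in> proj_set X V (carrier G)"
    "\<And>V. V \<in> A \<Longrightarrow> mdist (space_of X V) (p V) (p' V) \<le> E" by metis
  obtain y where y: "y \<in> carrier G" and
    y': "\<And>V. V \<in> A \<Longrightarrow> dist_in X V (proj X V y) {p' V} \<le> E"
      "\<And>V U. V \<in> A \<Longrightarrow> U \<in> domains X \<Longrightarrow> proper_nest X V U \<or> transverse X U V \<Longrightarrow>
             dist_in X U (proj X U y) (rho X V U) \<le> E"
    using partial_realisation[OF A p'(1)] by blast
  have "dd V (pt V y) (p V) \<le> 3 * E" if V: "V \<in> A" for V
  proof -
    have VD: "V \<in> domains X" using V A by blast
    have p'M: "p' V \<in> mspace (space_of X V)"
      using p'(1)[OF V] proj_coarse[OF VD] unfolding proj_set_def coarse_point_def by blast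
    have "dd V (pt V y) (p' V) \<le> 2 * E + \<epsilon>" if "\<epsilon> > 0" for \<epsilon>
    proof -
      have "proj X V y \<noteq> {}" using proj_coarse[OF VD y] unfolding coarse_point_def by blast
      then obtain a where a: "a \<in> proj X V y" "mdist (space_of X V) a (p' V) < E + \<epsilon>"
        using y'(1)[OF V] \<open>\<epsilon> > 0\<close> sdist_attained[of "mdist (space_of X V)" "proj X V y" "{p' V}" "E + \<epsilon>"]
        unfolding dist_in_def by auto
      then have aM: "a \<in> mspace (space_of X V)"
        using proj_coarse[OF VD y] unfolding coarse_point_def by blast
      have "dd V a (pt V y) \<le> E" using coarse_point_rep(3)[OF proj_coarse[OF VD y] a(1)] aM pt_in[OF VD y]
        by (simp add: dd_eq flip: pt_def)
      moreover have "dd V a (p' V) < E + \<epsilon>" using a aM p'M by (simp add: dd_eq)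
      ultimately show ?thesis using dd_triangle(3)[OF VD, of "pt V y" "p' V" a] by linarith
    qed
    then have "dd V (pt V y) (p' V) \<le> 2 * E" by (rule field_le_epsilon)
    moreover have "dd V (p V) (p' V) \<le> E" using p'(2)[OF V] p[OF V] p'M by (simp add: dd_eq)
    ultimately show ?thesis using dd_triangle(2)[OF VD, of "pt V y" "p V" "p' V"] by linarith
  qed
  moreover have "dd U (pt U y) (rpt V U) \<le> 3 * E"
    if V: "V \<in> A" and U: "U \<in> domains X" "\<not> nest X U V" "\<not> orth X V U" for U V
  proof -
    have VD: "V \<in> domains X" using V A by blast
    have "proper_nest X V U \<or> transverse X U V"
      using U orth_commute VD nest_refl unfolding proper_nest_def transverse_def by blast
    then show ?thesis using pt_rho_dist[OF U(1) VD U(2,3) y] y'(2)[OF V U(1)] by blast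
  qed
  ultimately show ?thesis using y by blast
qed

section \<open>Finiteness of the set of domains that separate two group elements\<close>

lemma nest_wf: "wf {(U, V). U \<in> domains X \<and> V \<in> domains X \<and> proper_nest X U V}"
proof (rule ccontr)
  assume "\<not> ?thesis"
  then obtain f where f: "\<And>i. f i \<in> domains X" "\<And>i. proper_nest X (f (Suc i)) (f i)"
    unfolding wf_iff_no_infinite_down_chain by blast
  have less: "proper_nest X (f j) (f i)" if "i < j" for i j
    using that
  proof (induction rule: less_Suc_induct)
    case (2 i j k)
    then show ?case using f(1) nest_trans nest_antisym unfolding proper_nest_def by metis
  qed (use f in auto)
  have "inj f"
    by (rule linorder_injI) (use less in \<open>metis proper_nest_def\<close>)
  moreover have "\<forall>U\<in>range f. \<forall>V\<in>range f. nest X U V \<or> nest X V U"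
    using less nest_refl f(1) unfolding proper_nest_def by (metis imageE linorder_neqE_nat)
  then have "finite (range f)" using finite_complexity f(1) by (metis image_subsetI)
  ultimately show False using finite_imageD by blast
qed

lemma nest_minimal:
  assumes "A \<subseteq> domains X" "A \<noteq> {}"
  shows "\<exists>V\<in>A. \<forall>U\<in>A. nest X U V \<longrightarrow> U = V"
proof -
  obtain a where "a \<in> A" using assms by blast
  from wfE_min[OF nest_wf this] obtain V where "V \<in> A"
    "\<And>U. (U, V) \<in> {(U, V). U \<in> domains X \<and> V \<in> domains X \<and> proper_nest X U V} \<Longrightarrow> U \<notin> A"
    by blast
  then show ?thesis using assms(1) unfolding proper_nest_def by blast
qed

text \<open>The axiom only provides a unique maximal element. Finite complexity gives a largest
  chain through \<open>U\<close> that has a top; that top is maximal, hence equal to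
  \<open>M\<close>.\<close>

lemma nest_top: "\<exists>M\<in>domains X. \<forall>U\<in>domains X. nest X U M"
proof -
  obtain n where n: "\<And>\<C>. \<C> \<subseteq> domains X \<Longrightarrow> (\<forall>U\<in>\<C>. \<forall>V\<in>\<C>. nest X U V \<or> nest X V U) \<Longrightarrow> finite \<C> \<and> card \<C> \<le> n"
    using finite_complexity by blast
  obtain M where M: "M \<in> domains X" "\<And>W. W \<in> domains X \<Longrightarrow> \<forall>V\<in>domains X. nest X W V \<longrightarrow> V = W \<Longrightarrow> W = M"
    using nest_max by blast
  have "nest X U M" if U: "U \<in> domains X" for U
  proof -
    define chain where "chain \<C> \<longleftrightarrow> U \<in> \<C> \<and> \<C> \<subseteq> domains X \<and> (\<forall>V\<in>\<C>. \<forall>W\<in>\<C>. nest X V W \<or> nest X W V) \<and>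
      (\<exists>T\<in>\<C>. \<forall>V\<in>\<C>. nest X V T)" for \<C>
    have "chain {U}" using U nest_refl by (simp add: chain_def)
    moreover have "\<forall>\<C>. chain \<C> \<longrightarrow> card \<C> < Suc n" using n by (auto simp: chain_def less_Suc_eq_le)
    ultimately obtain \<C> where \<C>: "chain \<C>" "\<And>\<B>. chain \<B> \<Longrightarrow> card \<B> \<le> card \<C>"
      using ex_has_greatest_nat[of chain "{U}" card "Suc n"] by auto
    then obtain T where T: "T \<in> \<C>" "\<And>V. V \<in> \<C> \<Longrightarrow> nest X V T" by (auto simp: chain_def)
    have TD: "T \<in> domains X" and CD: "\<C> \<subseteq> domains X" using T \<C> by (auto simp: chain_def)
    have "V = T" if V: "V \<in> domains X" "nest X T V" for V
    proof -
      have below: "nest X W V" if "W \<in> \<C>" for W using nest_trans[of W T V] T that V TD CD by blast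
      have "chain (insert V \<C>)"
        using \<C>(1) V below nest_refl unfolding chain_def by blast
      then have "card (insert V \<C>) \<le> card \<C>" using \<C>(2) by blast
      moreover have "finite \<C>" using n[of \<C>] \<C>(1) unfolding chain_def by blast
      ultimately have "V \<in> \<C>" by (metis card_insert_disjoint lessI not_less)
      then show ?thesis using T V TD nest_antisym by blast
    qed
    then have "T = M" using M(2) TD by blast
    moreover have "U \<in> \<C>" using \<C>(1) by (simp add: chain_def)
    ultimately show ?thesis using T by blast
  qed
  then show ?thesis using M(1) by blast
qed

text \<open>Induction along nesting: by large links, every relevant domain properly below
  \<open>W\<close> lies below one of finitely many domains that are themselves properly below
  \<open>W\<close>.\<close>

lemma finite_relevant_below:
  assumes x: "x \<in> carrier G" "y \<in> carrier G" and W: "W \<in> domains X"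
  shows "finite {T \<in> domains X. nest X T W \<and> dproj X T x y \<ge> E}"
  using nest_wf W
proof (induction W rule: wf_induct_rule)
  case (less W)
  obtain L where L: "\<forall>W\<in>domains X. \<forall>x\<in>carrier G. \<forall>x'\<in>carrier G.
        let N = L * dproj X W x x' + L in
        \<exists>\<T> \<subseteq> {T \<in> domains X. proper_nest X T W}. finite \<T> \<and> card \<T> \<le> nat \<lfloor>N\<rfloor> \<and>
          (\<forall>T\<in>domains X. proper_nest X T W \<longrightarrow> (\<exists>T'\<in>\<T>. nest X T T') \<or> dproj X T x x' < E) \<and>
          (\<forall>T\<in>\<T>. dist_in X W (proj X W x) (rho X T W) \<le> N)"
    using large_links by auto
  obtain \<T> where \<T>: "\<T> \<subseteq> {T \<in> domains X. proper_nest X T W}" "finite \<T>"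
    "\<forall>T\<in>domains X. proper_nest X T W \<longrightarrow> (\<exists>T'\<in>\<T>. nest X T T') \<or> dproj X T x y < E"
    using L[unfolded Let_def, rule_format, OF less.prems x] by blast
  have "{T \<in> domains X. nest X T W \<and> dproj X T x y \<ge> E} \<subseteq>
    insert W (\<Union>T'\<in>\<T>. {T \<in> domains X. nest X T T' \<and> dproj X T x y \<ge> E})"
    using \<T>(3) unfolding proper_nest_def by force
  moreover have "finite (\<Union>T'\<in>\<T>. {T \<in> domains X. nest X T T' \<and> dproj X T x y \<ge> E})"
    using \<T>(1,2) less by auto
  ultimately show ?case by (meson finite_insert finite_subset)
qed

lemma finite_relevant_points:
  assumes "x \<in> carrier G" "y \<in> carrier G"
  shows "finite {T \<in> domains X. dd T (pt T x) (pt T y) > 3 * E}"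
proof -
  obtain M where M: "M \<in> domains X" "\<forall>U\<in>domains X. nest X U M" using nest_top by blast
  have "dproj X T x y \<ge> E" if "T \<in> domains X" "dd T (pt T x) (pt T y) > 3 * E" for T
    using pt_dist[OF that(1) assms, of E] that(2) by force
  then have "{T \<in> domains X. dd T (pt T x) (pt T y) > 3 * E} \<subseteq> {T \<in> domains X. nest X T M \<and> dproj X T x y \<ge> E}"
    using M(2) by blast
  then show ?thesis using finite_relevant_below[OF assms M(1)] by (rule finite_subset)
qed

end

section \<open>Coarse Helly property and bounded packing\<close>

lemma word_dist_nonneg: "0 \<le> word_dist G S x y"
  by (simp add: word_dist_def)

lemma near_minimiser:
  fixes f :: "'a \<Rightarrow> real"
  assumes "A \<noteq> {}" "\<And>a. a \<in> A \<Longrightarrow> 0 \<le> f a"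
  shows "\<exists>a\<in>A. \<forall>a'\<in>A. f a \<le> f a' + 1"
proof -
  have bdd: "bdd_below (f ` A)" using assms(2) by (auto intro!: bdd_belowI[of _ 0])
  then obtain a where a: "a \<in> A" "f a < Inf (f ` A) + 1"
    using cINF_less_iff[OF assms(1), of f "Inf (f ` A) + 1"] by auto
  have "f a \<le> f a' + 1" if "a' \<in> A" for a' using cINF_lower[OF bdd that] a(2) by linarith
  then show ?thesis using a(1) by blast
qed

lemma finite_argmax:
  fixes f :: "'a \<Rightarrow> real"
  assumes "finite A" "A \<noteq> {}"
  shows "\<exists>a\<in>A. \<forall>a'\<in>A. f a' \<le> f a"
proof -
  have "Max (f ` A) \<in> f ` A" using assms by simp
  then obtain a where "a \<in> A" "Max (f ` A) = f a" by blast
  then show ?thesis using Max_ge[of "f ` A"] assms(1) by (metis finite_imageI imageI)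
qed

lemma (in group) foldr_mult:
  assumes "set ws \<subseteq> carrier G" "g \<in> carrier G"
  shows "foldr (\<lambda>a b. a \<otimes> b) ws g = foldr (\<lambda>a b. a \<otimes> b) ws \<one> \<otimes> g"
proof -
  have "foldr (\<otimes>) ws g = foldr (\<otimes>) ws \<one> \<otimes> g \<and> foldr (\<otimes>) ws \<one> \<in> carrier G"
    using assms by (induction ws) (auto simp: m_assoc)
  then show ?thesis by blast
qed

context hhg
begin

section \<open>Balls of the word metric and transport of cosets to the subgroup\<close>

abbreviation letters :: "'g set" where
  "letters \<equiv> gens X \<union> (\<lambda>a. inv a) ` gens X"

lemma letters_closed: "letters \<subseteq> carrier G"
  using gens(2) by auto

text \<open>This makes the minimum in \<open>word_length\<close> attained, so that a bound on the
  length yields an actual short word.\<close>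

lemma word_ex:
  assumes "g \<in> carrier G"
  shows "\<exists>ws. set ws \<subseteq> letters \<and> foldr (\<lambda>a b. a \<otimes> b) ws \<one> = g"
proof -
  have "g \<in> generate G (gens X)" using assms gens(3) by simp
  then show ?thesis
  proof (induction rule: generate.induct)
    case one
    then show ?case by (intro exI[of _ "[]"]) simp
  next
    case (incl h)
    then show ?case using gens(2) by (intro exI[of _ "[h]"]) auto
  next
    case (inv h)
    then show ?case using gens(2) by (intro exI[of _ "[inv h]"]) auto
  next
    case (eng h1 h2)
    then obtain ws vs where *: "set ws \<subseteq> letters" "foldr (\<lambda>a b. a \<otimes> b) ws \<one> = h1"
      "set vs \<subseteq> letters" "foldr (\<lambda>a b. a \<otimes> b) vs \<one> = h2" by (elim exE conjE)
    have "h2 \<in> carrier G" using eng(2) gens(3) by simp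
    then have "foldr (\<lambda>a b. a \<otimes> b) (ws @ vs) \<one> = h1 \<otimes> h2"
      using foldr_mult[of ws h2, OF subset_trans[OF *(1) letters_closed]] by (simp add: *(2,4))
    moreover have "set (ws @ vs) \<subseteq> letters" using *(1,3) by simp
    ultimately show ?case by (intro exI[of _ "ws @ vs"] conjI)
  qed
qed

lemma finite_word_ball: "finite {g \<in> carrier G. real (word_length G (gens X) g) \<le> r}"
proof (rule finite_subset)
  let ?n = "nat \<lfloor>r\<rfloor>"
  show "finite ((\<lambda>ws. foldr (\<lambda>a b. a \<otimes> b) ws \<one>) ` {ws. set ws \<subseteq> letters \<and> length ws \<le> ?n})"
    by (intro finite_imageI finite_lists_length_le) (use gens(1) in simp)
  show "{g \<in> carrier G. real (word_length G (gens X) g) \<le> r} \<subseteq>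
    (\<lambda>ws. foldr (\<lambda>a b. a \<otimes> b) ws \<one>) ` {ws. set ws \<subseteq> letters \<and> length ws \<le> ?n}"
  proof
    fix g
    assume "g \<in> {g \<in> carrier G. real (word_length G (gens X) g) \<le> r}"
    then have g: "g \<in> carrier G" "real (word_length G (gens X) g) \<le> r" by auto
    have "\<exists>n ws. length ws = n \<and> set ws \<subseteq> letters \<and> foldr (\<lambda>a b. a \<otimes> b) ws \<one> = g"
      using word_ex[OF g(1)] by simp
    from LeastI_ex[OF this] obtain ws where ws: "length ws = word_length G (gens X) g"
      "set ws \<subseteq> letters" "foldr (\<lambda>a b. a \<otimes> b) ws \<one> = g"
      unfolding word_length_def by (elim exE conjE)
    moreover have "word_length G (gens X) g \<le> ?n" using g(2) by (simp add: le_nat_floor)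
    ultimately show "g \<in> (\<lambda>ws. foldr (\<lambda>a b. a \<otimes> b) ws \<one>) ` {ws. set ws \<subseteq> letters \<and> length ws \<le> ?n}"
      by (intro image_eqI[of _ _ ws]) simp_all
  qed
qed

text \<open>Hierarchical quasiconvexity is assumed for \<open>H\<close> only. Translating by
  \<open>inv g\<close> turns nearness to the coset into nearness of \<open>inv g \<otimes> y\<close>
  to \<open>H\<close>, through the isometries between the spaces. The final 1 replaces an infimal
  distance by a point.\<close>

lemma coset_near:
  assumes H: "subgroup H G" and g: "g \<in> carrier G" and y: "y \<in> carrier G"
    and hq: "hier_quasiconvex_with k G X H" and "0 \<le> \<theta>"
    and near: "\<And>U. U \<in> domains X \<Longrightarrow> \<exists>q\<in>g <# H. dd U (pt U y) (pt U q) \<le> \<theta>"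
  shows "\<exists>q\<in>g <# H. word_dist G (gens X) y q \<le> k \<theta> + 1"
proof -
  have HG: "H \<subseteq> carrier G" using H by (rule subgroup.subset)
  let ?y = "inv g \<otimes> y"
  have y': "?y \<in> carrier G" "g \<otimes> ?y = y" using g y by (simp_all flip: m_assoc)
  have "dist_in X W (proj X W ?y) (proj_set X W H) \<le> \<theta>" if W: "W \<in> domains X" for W
  proof -
    let ?U = "dom_act X g W" and ?f = "dom_iso X g W"
    have U: "?U \<in> domains X" using group_action.element_image[OF action g W] by simp
    obtain h where h: "h \<in> H" "dd ?U (pt ?U y) (pt ?U (g \<otimes> h)) \<le> \<theta>"
      using near[OF U] unfolding l_coset_def by blast
    have hG: "h \<in> carrier G" using h HG by blast
    have "pt ?U y \<in> ?f ` proj X W ?y"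
      unfolding act_proj[OF g W y'(1)] y'(2) pt_def by (rule coarse_point_rep(1)[OF proj_coarse[OF U y]])
    then obtain a where a: "pt ?U y = ?f a" "a \<in> proj X W ?y" by (rule imageE)
    have "pt ?U (g \<otimes> h) \<in> ?f ` proj X W h"
      unfolding act_proj[OF g W hG] pt_def by (rule coarse_point_rep(1)[OF proj_coarse[OF U m_closed[OF g hG]]])
    then obtain c where c: "pt ?U (g \<otimes> h) = ?f c" "c \<in> proj X W h" by (rule imageE)
    have M: "a \<in> mspace (space_of X W)" "c \<in> mspace (space_of X W)"
      using a c proj_coarse[OF W y'(1)] proj_coarse[OF W hG] unfolding coarse_point_def by blast+
    have "mdist (space_of X W) a c = mdist (space_of X ?U) (pt ?U y) (pt ?U (g \<otimes> h))"
      unfolding a(1) c(1) using act_iso[OF g W] M unfolding isometry_onto_def by simp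
    also have "\<dots> \<le> \<theta>" using h(2) dd_eq[OF pt_in[OF U y] pt_in[OF U m_closed[OF g hG]]] by simp
    finally have "mdist (space_of X W) a c \<le> \<theta>" .
    moreover have "c \<in> proj_set X W H" using c h unfolding proj_set_def by blast
    ultimately show ?thesis
      using sdist_le[of "mdist (space_of X W)", OF mdist_nonneg a(2), of c "proj_set X W H"]
      unfolding dist_in_def by linarith
  qed
  then have "sdist (word_dist G (gens X)) {?y} H \<le> k \<theta>"
    using hq \<open>0 \<le> \<theta>\<close> y'(1) unfolding hier_quasiconvex_with_def by blast
  moreover have "H \<noteq> {}" using subgroup.one_closed[OF H] by blast
  ultimately obtain h where h: "h \<in> H" "word_dist G (gens X) ?y h < k \<theta> + 1"
    using sdist_attained[of "word_dist G (gens X)" "{?y}" H "k \<theta> + 1", OF word_dist_nonneg] by auto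
  have hG: "h \<in> carrier G" using h HG by blast
  have "inv ?y \<otimes> h = inv y \<otimes> (g \<otimes> h)" using g y hG by (simp add: inv_mult_group m_assoc)
  then have "word_dist G (gens X) y (g \<otimes> h) \<le> k \<theta> + 1" using h(2) by (simp add: word_dist_def)
  then show ?thesis using h(1) unfolding l_coset_def by blast
qed

text \<open>The isometry induced by \<open>inv g\<close> carries geodesics at the coset to geodesics
  at \<open>H\<close>. The extra \<open>E\<close> pays for using representatives instead of the
  whole projections.\<close>

lemma coset_quasiconvex:
  assumes H: "subgroup H G" and g: "g \<in> carrier G" and U: "U \<in> domains X"
    and qc: "\<And>W. W \<in> domains X \<Longrightarrow> quasiconvex (space_of X W) k (proj_set X W H)"
  shows "quasiconvex (space_of X U) (k + E) (pt U ` (g <# H))"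
  unfolding quasiconvex_def
proof (intro ballI allI impI subsetI)
  fix x x' \<gamma> w
  assume x: "x \<in> pt U ` (g <# H)" "x' \<in> pt U ` (g <# H)"
    and \<gamma>: "geodesic_between (space_of X U) x x' \<gamma>" and w: "w \<in> \<gamma>"
  have HG: "H \<subseteq> carrier G" using H by (rule subgroup.subset)
  let ?W = "dom_act X (inv g) U" and ?f = "dom_iso X (inv g) U"
  have g': "inv g \<in> carrier G" using g by simp
  have W: "?W \<in> domains X" using group_action.element_image[OF action g' U] by simp
  note iso = act_iso[OF g' U]
  have proj_eq: "?f ` proj X U (g \<otimes> h) = proj X ?W h" if "h \<in> H" for h
  proof -
    have "h \<in> carrier G" using that HG by blast
    then show ?thesis using act_proj[OF g' U, of "g \<otimes> h"] g by (simp flip: m_assoc)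
  qed
  have in_proj: "pt U (g \<otimes> h) \<in> proj X U (g \<otimes> h)" if "h \<in> H" for h
    unfolding pt_def using that HG g by (intro coarse_point_rep(1)[OF proj_coarse[OF U]]) auto
  have "?f v \<in> proj_set X ?W H" if "v \<in> pt U ` (g <# H)" for v
  proof -
    from that obtain h where "h \<in> H" "v = pt U (g \<otimes> h)" by (auto simp: l_coset_def)
    then have "?f v \<in> proj X ?W h" using proj_eq in_proj by blast
    then show ?thesis using \<open>h \<in> H\<close> unfolding proj_set_def by blast
  qed
  then have "?f ` \<gamma> \<subseteq> nbhd (space_of X ?W) k (proj_set X ?W H)"
    using qc[OF W] geodesic_isometry_image[OF iso \<gamma>] x unfolding quasiconvex_def by blast
  then obtain h a where h: "h \<in> H" "a \<in> proj X ?W h" "mdist (space_of X ?W) (?f w) a \<le> k"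
    using w unfolding nbhd_def proj_set_def by blast
  then obtain a' where a': "a' \<in> proj X U (g \<otimes> h)" "a = ?f a'" using proj_eq by blast
  have gh: "g \<otimes> h \<in> carrier G" using g h HG by blast
  have M: "w \<in> mspace (space_of X U)" "a' \<in> mspace (space_of X U)"
    using geodesic_ends(3)[OF \<gamma>] w a' proj_coarse[OF U gh] unfolding coarse_point_def by blast+
  have "mdist (space_of X U) w a' \<le> k"
    using h(3) iso M unfolding a'(2) isometry_onto_def by simp
  moreover have "mdist (space_of X U) a' (pt U (g \<otimes> h)) \<le> E"
    using coarse_point_rep(3)[OF proj_coarse[OF U gh] a'(1)] by (simp add: pt_def)
  ultimately have "mdist (space_of X U) w (pt U (g \<otimes> h)) \<le> k + E"
    using mdist_triangle4(1)[OF M pt_in[OF U gh]] by linarith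
  then show "w \<in> nbhd (space_of X U) (k + E) (pt U ` (g <# H))"
    using M(1) h(1) unfolding nbhd_def l_coset_def by blast
qed

text \<open>The tuple to realise: in \<open>\<C>U\<close>, the point \<open>b U\<close> is a nearest point to \<open>\<pi>\<^sub>U(\<one>)\<close> in the projection of
  the set \<open>A U\<close> whose projection is farthest from \<open>\<pi>\<^sub>U(\<one>)\<close>.\<close>

lemma coarse_helly:
  assumes orth_card: "\<And>A. A \<subseteq> domains X \<Longrightarrow> pairwise (orth X) A \<Longrightarrow> finite A \<and> card A \<le> N"
    and k: "0 \<le> k" and fin: "finite \<C>" "\<C> \<noteq> {}"
    and sets: "\<And>A. A \<in> \<C> \<Longrightarrow> A \<noteq> {} \<and> A \<subseteq> carrier G"
    and qc: "\<And>A U. A \<in> \<C> \<Longrightarrow> U \<in> domains X \<Longrightarrow> quasiconvex (space_of X U) k (pt U ` A)"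
    and close: "\<And>A B U. A \<in> \<C> \<Longrightarrow> B \<in> \<C> \<Longrightarrow> U \<in> domains X \<Longrightarrow> \<exists>a\<in>A. \<exists>b\<in>B. dd U (pt U a) (pt U b) \<le> r"
    and h: "h = helly_const E k r" and c: "c = h + 24 * E + k + 1"
  shows "\<exists>y\<in>carrier G. \<forall>U\<in>domains X. \<forall>A\<in>\<C>. \<exists>a\<in>A. dd U (pt U y) (pt U a) \<le> 7 * c + h"
proof -
  note E = E_nonneg
  obtain B\<^sub>0 U\<^sub>0 where "B\<^sub>0 \<in> \<C>" "U\<^sub>0 \<in> domains X" using fin(2) domain_ex by blast
  from close[OF this(1) this] obtain a a' where "dd U\<^sub>0 (pt U\<^sub>0 a) (pt U\<^sub>0 a') \<le> r" by blast
  then have "0 \<le> r" using dd_nonneg[of U\<^sub>0 "pt U\<^sub>0 a" "pt U\<^sub>0 a'"] by linarith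
  then have h0: "0 \<le> h" using h k E by (simp add: helly_const_def)
  have tuple_ex: "\<exists>A q. A \<in> \<C> \<and> q \<in> A \<and> (\<forall>q'\<in>A. dd U (pt U \<one>) (pt U q) \<le> dd U (pt U \<one>) (pt U q') + 1) \<and>
      (\<forall>B\<in>\<C>. \<exists>q'\<in>B. dd U (pt U q) (pt U q') \<le> h)" if U: "U \<in> domains X" for U
  proof -
    let ?m = "space_of X U" and ?x = "pt U \<one>"
    have dd_pt: "dd U (pt U y) (pt U z) = mdist ?m (pt U y) (pt U z)"
      if "y \<in> carrier G" "z \<in> carrier G" for y z using dd_eq pt_in U that by blast
    have "\<exists>q\<in>B. \<forall>q'\<in>B. dd U ?x (pt U q) \<le> dd U ?x (pt U q') + 1" if "B \<in> \<C>" for B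
      by (rule near_minimiser) (use sets[OF that] dd_nonneg in auto)
    then obtain q where q: "\<And>B. B \<in> \<C> \<Longrightarrow> q B \<in> B"
      "\<And>B q'. B \<in> \<C> \<Longrightarrow> q' \<in> B \<Longrightarrow> dd U ?x (pt U (q B)) \<le> dd U ?x (pt U q') + 1" by metis
    obtain A where A: "A \<in> \<C>" "\<And>B. B \<in> \<C> \<Longrightarrow> dd U ?x (pt U (q B)) \<le> dd U ?x (pt U (q A))"
      using finite_argmax[OF fin, of "\<lambda>B. dd U ?x (pt U (q B))"] by blast
    have "\<exists>q'\<in>B. dd U (pt U (q A)) (pt U q') \<le> h" if B: "B \<in> \<C>" for B
    proof -
      obtain u v where uv: "u \<in> A" "v \<in> B" "dd U (pt U u) (pt U v) \<le> r" using close A(1) B U by blast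
      have AG: "A \<subseteq> carrier G" "B \<subseteq> carrier G" using sets A(1) B by auto
      have in_space: "pt U ` A \<subseteq> mspace ?m" "pt U ` B \<subseteq> mspace ?m" using AG pt_in[OF U] by auto
      have gates: "mdist ?m ?x (pt U (q C)) \<le> mdist ?m ?x p + 1" if "C \<in> \<C>" "p \<in> pt U ` C" for C p
      proof -
        obtain q' where q': "q' \<in> C" "p = pt U q'" using \<open>p \<in> pt U ` C\<close> by blast
        then have "q' \<in> carrier G" "q C \<in> carrier G" using sets q(1) \<open>C \<in> \<C>\<close> by blast+
        then show ?thesis using q(2)[OF \<open>C \<in> \<C>\<close> q'(1)] q'(2) dd_pt by simp
      qed
      have "\<exists>p\<in>pt U ` B. mdist ?m (pt U (q A)) p \<le> helly_const E k r"
      proof (rule farther_gate_near[where x = "?x" and u = "pt U u" and v = "pt U v" and g\<^sub>2 = "pt U (q B)"])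
        show "hyperbolic E ?m" "geodesic_space ?m" using spaces[OF U] by auto
        show "mdist ?m ?x (pt U (q B)) \<le> mdist ?m ?x (pt U (q A))"
          using A(2)[OF B] q(1)[OF A(1)] q(1)[OF B] AG dd_pt by (metis one_closed subsetD)
        show "mdist ?m (pt U u) (pt U v) \<le> r" using uv AG dd_pt by (metis subsetD)
      qed (fact E k qc[OF A(1) U] qc[OF B U] in_space pt_in[OF U one_closed] imageI[OF uv(1)]
            imageI[OF uv(2)] imageI[OF q(1)[OF A(1)]] imageI[OF q(1)[OF B]]
            gates[OF A(1)] gates[OF B])+
      then obtain q' where q': "q' \<in> B" "mdist ?m (pt U (q A)) (pt U q') \<le> h" using h by blast
      moreover have "q' \<in> carrier G" "q A \<in> carrier G" using q'(1) q(1)[OF A(1)] AG by auto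
      ultimately have "dd U (pt U (q A)) (pt U q') \<le> h" using dd_pt by simp
      then show ?thesis using q'(1) by blast
    qed
    then show ?thesis using A q by blast
  qed
  then obtain A q where A: "\<And>U. U \<in> domains X \<Longrightarrow> A U \<in> \<C>" and q: "\<And>U. U \<in> domains X \<Longrightarrow> q U \<in> A U"
    and gate: "\<And>U q'. U \<in> domains X \<Longrightarrow> q' \<in> A U \<Longrightarrow>
      dd U (pt U \<one>) (pt U (q U)) \<le> dd U (pt U \<one>) (pt U q') + 1"
    and near: "\<And>U B. U \<in> domains X \<Longrightarrow> B \<in> \<C> \<Longrightarrow> \<exists>q'\<in>B. dd U (pt U (q U)) (pt U q') \<le> h"
    by metis
  have AG: "A U \<subseteq> carrier G" "q U \<in> carrier G" if "U \<in> domains X" for U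
    using sets[OF A[OF that]] q[OF that] by auto
  define b where "b U = pt U (q U)" for U
  have b_in: "b U \<in> mspace (space_of X U)" if "U \<in> domains X" for U
    using pt_in[OF that] AG(2)[OF that] by (simp add: b_def)

  text \<open>If \<open>b\<^sub>U\<close>, as a nearest point of \<open>A U\<close> to \<open>\<one>\<close>, is farther than \<open>\<rho>\<^sup>V\<^sub>U\<close>, then so is all of \<open>A U\<close>.\<close>
  have transverse_one_side: "dd V (b V) (rpt U V) \<le> c"
    if D: "U \<in> domains X" "V \<in> domains X" and UV: "\<not> nest X U V" "\<not> nest X V U" "\<not> orth X U V"
      and x: "dd U (pt U \<one>) (rpt V U) \<le> 3 * E" and far: "dd U (b U) (rpt V U) > c" for U V
  proof -
    obtain q' where q': "q' \<in> A U" "dd V (b V) (pt V q') \<le> h"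
      using near[OF D(2) A[OF D(1)]] by (auto simp: b_def)
    have "dd U (pt U \<one>) (b U) \<le> dd U (pt U \<one>) (pt U q') + 1" using gate[OF D(1) q'(1)] by (simp add: b_def)
    then have "dd U (pt U q') (rpt V U) > 3 * E"
      using far x dd_triangle(3)[OF D(1), of "b U" "rpt V U" "pt U \<one>"]
        dd_triangle(2)[OF D(1), of "pt U \<one>" "pt U q'" "rpt V U"] c h0 k E by linarith
    then have "dd V (pt V q') (rpt U V) \<le> 3 * E"
      using pt_consistent[OF D UV, of q'] q'(1) AG(1)[OF D(1)] by fastforce
    then show ?thesis
      using q'(2) dd_triangle(1)[OF D(2), of "b V" "rpt U V" "pt V q'"] c k E by linarith
  qed

  interpret tuple: consistent_tuple "domains X" "nest X" "orth X" dd "carrier G" pt rpt b c N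
  proof unfold_locales
    fix U V y
    assume D: "U \<in> domains X" "V \<in> domains X" and nest: "nest X U V" "U \<noteq> V" and y: "y \<in> carrier G"
      and far: "dd V (pt V y) (b V) + c < dd V (b V) (rpt U V)"
    have UV: "proper_nest X U V" using nest by (simp add: proper_nest_def)
    \<comment> \<open>\<open>\<beta>\<close> is the value in \<open>U\<close> predicted by
      \<open>b V\<close>. Both \<open>pt U y\<close> and \<open>b U\<close> are compared with it:
      the errors 6E and h + 18E + 1 add up to the main part of \<open>c\<close>.\<close>
    define \<beta> where "\<beta> = rmap V U (b V)"
    have far': "c < dd V (b V) (rpt U V)" using far dd_nonneg[of V "pt V y" "b V"] by linarith
    have near_\<beta>: "dd U (pt U z) \<beta> \<le> 6 * E"
      if "z \<in> carrier G" "dd V (b V) (rpt U V) > dd V (pt V z) (b V) + 3 * E" for z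
      unfolding \<beta>_def by (rule pt_near_rmap_short[OF D UV that(1) b_in[OF D(2)] that(2)])
    obtain \<gamma> where \<gamma>: "geodesic_between (space_of X V) (pt V \<one>) (b V) \<gamma>"
      using geodesic_ex[OF D(2) pt_in[OF D(2) one_closed] b_in[OF D(2)]] by blast
    have split: "dd V p w + dd V w p' = dd V p p'"
      if "geodesic_between (space_of X V) p p' \<eta>" "w \<in> \<eta>" for p p' w \<eta>
      using geodesic_split[OF that] geodesic_ends[OF that(1)] that(2) by (simp add: dd_eq subset_iff)
    have b\<beta>: "dd U (b U) \<beta> \<le> h + 18 * E + 1"
      \<comment> \<open>If the geodesic from \<open>\<pi>\<^sub>V(\<one>)\<close> to \<open>b V\<close> passes near \<open>\<rho>\<^sup>U\<^sub>V\<close>, no geodesic from \<open>b V\<close> inside the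
        nearly convex projection of \<open>A V\<close> does, so all of \<open>A V\<close> has the same image in \<open>\<C>U\<close>.\<close>
    proof (cases "\<forall>w\<in>\<gamma>. dd V w (rpt U V) > 3 * E")
      case True
      then have x\<beta>: "dd U (pt U \<one>) \<beta> \<le> 6 * E"
        using pt_near_rmap[OF D UV one_closed \<gamma>] unfolding \<beta>_def by blast
      \<comment> \<open>As \<open>b V\<close> is far from \<open>rpt U V\<close>, a point of
        \<open>A U\<close> within \<open>h\<close> of it in \<open>V\<close> also projects near
        \<open>\<beta>\<close> in \<open>U\<close>. So does the identity, and the nearest-point
        property then keeps \<open>b U\<close> close as well.\<close>
      obtain q' where q': "q' \<in> A U" "dd V (b V) (pt V q') \<le> h"
        using near[OF D(2) A[OF D(1)]] by (auto simp: b_def)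
      then have "dd U (pt U q') \<beta> \<le> 6 * E"
        using near_\<beta>[of q'] AG(1)[OF D(1)] far' dd_sym[of V "b V" "pt V q'"] c k E by fastforce
      then have "dd U (pt U \<one>) (b U) \<le> 12 * E + 1"
        using gate[OF D(1) q'(1)] x\<beta> dd_triangle(2)[OF D(1), of "pt U \<one>" "pt U q'" \<beta>]
        unfolding b_def by linarith
      then show ?thesis
        using x\<beta> dd_triangle(3)[OF D(1), of "b U" \<beta> "pt U \<one>"] h0 by linarith
    next
      case False
      then obtain w where w: "w \<in> \<gamma>" "dd V w (rpt U V) \<le> 3 * E" by force
      obtain q' where q': "q' \<in> A V" "dd U (b U) (pt U q') \<le> h"
        using near[OF D(1) A[OF D(2)]] by (auto simp: b_def)
      have q'G: "q' \<in> carrier G" using q' AG(1)[OF D(2)] by blast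
      obtain \<gamma>' where \<gamma>': "geodesic_between (space_of X V) (pt V q') (b V) \<gamma>'"
        using geodesic_ex[OF D(2) pt_in[OF D(2) q'G] b_in[OF D(2)]] by blast
      have "dd V w' (rpt U V) > 3 * E" if w': "w' \<in> \<gamma>'" for w'
      proof (rule ccontr)
        assume "\<not> ?thesis"
        then have w'_near: "dd V w' (rpt U V) \<le> 3 * E" by simp
        have "w' \<in> nbhd (space_of X V) k (pt V ` A V)"
          using qc[OF A[OF D(2)] D(2)] \<gamma>' w' q'(1) q[OF D(2)] unfolding quasiconvex_def b_def by blast
        then obtain q'' where q'': "q'' \<in> A V" "dd V w' (pt V q'') \<le> k"
          using AG(1)[OF D(2)] pt_in[OF D(2)] unfolding nbhd_def by (auto simp: dd_eq subset_iff)
        \<comment> \<open>Both \<open>w\<close> and \<open>w'\<close> are near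
          \<open>rpt U V\<close>, so \<open>A V\<close> has a point near \<open>w\<close>. Since
          \<open>b V\<close> is almost nearest and \<open>w\<close> lies on the way to it, little of
          \<open>\<gamma>\<close> remains after \<open>w\<close>, and \<open>b V\<close> is near
          \<open>rpt U V\<close> after all.\<close>
        have "dd V (pt V \<one>) (b V) \<le> dd V (pt V \<one>) (pt V q'') + 1"
          using gate[OF D(2) q''(1)] by (simp add: b_def)
        also have "dd V (pt V \<one>) (pt V q'') \<le> dd V (pt V \<one>) w + 6 * E + k"
          using dd_triangle(1)[OF D(2), of "pt V \<one>" "pt V q''" w] w(2) w'_near q''(2)
            dd_triangle(1)[OF D(2), of w "pt V q''" "w'"]
            dd_triangle(2)[OF D(2), of w "w'" "rpt U V"] by linarith
        finally have "dd V w (b V) \<le> 6 * E + k + 1" using split[OF \<gamma> w(1)] by linarith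
        then show False
          using far' w(2) dd_triangle(3)[OF D(2), of "b V" "rpt U V" w] c h0 E by linarith
      qed
      then have "dd U (pt U q') \<beta> \<le> 6 * E"
        using pt_near_rmap[OF D UV q'G \<gamma>'] unfolding \<beta>_def by blast
      then show ?thesis
        using q'(2) dd_triangle(1)[OF D(1), of "b U" \<beta> "pt U q'"] E by linarith
    qed
    have "dd U (pt U y) \<beta> \<le> 6 * E" using near_\<beta>[OF y] far c h0 k E by linarith
    then show "dd U (pt U y) (b U) \<le> c"
      using b\<beta> dd_triangle(2)[OF D(1), of "pt U y" "b U" \<beta>] c k by linarith
  next
    fix U V y
    assume D: "U \<in> domains X" "V \<in> domains X" "\<not> nest X U V" "\<not> nest X V U" "\<not> orth X U V"
      and y: "y \<in> carrier G"
    show "dd U (pt U y) (rpt V U) \<le> c \<or> dd V (pt V y) (rpt U V) \<le> c"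
      using pt_consistent[OF D y] c h0 k E by linarith
  next
    fix U V
    assume D: "U \<in> domains X" "V \<in> domains X" "\<not> nest X U V" "\<not> nest X V U" "\<not> orth X U V"
    then have D': "\<not> orth X V U" using orth_commute by blast
    show "dd U (b U) (rpt V U) \<le> c \<or> dd V (b V) (rpt U V) \<le> c"
      using pt_consistent[OF D one_closed] transverse_one_side[OF D]
        transverse_one_side[OF D(2,1,4,3) D'] by linarith
  next
    fix U V W
    assume "U \<in> domains X" "V \<in> domains X" "W \<in> domains X" "nest X U V" "\<not> nest X W V"
      "\<not> orth X V W" "\<not> orth X U W"
    from rpt_consistent[OF this] show "dd W (rpt U W) (rpt V W) \<le> c" using c h0 k E by linarith
  next
    fix \<A>
    assume "\<A> \<subseteq> domains X" "pairwise (orth X) \<A>"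
    then obtain y where "y \<in> carrier G" "\<forall>V\<in>\<A>. dd V (pt V y) (b V) \<le> 3 * E \<and>
      (\<forall>U\<in>domains X. \<not> nest X U V \<and> \<not> orth X V U \<longrightarrow> dd U (pt U y) (rpt V U) \<le> 3 * E)"
      using pt_realise[of \<A> b] b_in by blast
    moreover have "3 * E \<le> c" using c h0 k E by linarith
    ultimately show "\<exists>y\<in>carrier G. \<forall>V\<in>\<A>. dd V (pt V y) (b V) \<le> c \<and>
      (\<forall>U\<in>domains X. \<not> nest X U V \<and> \<not> orth X V U \<longrightarrow> dd U (pt U y) (rpt V U) \<le> c)"
      by (meson order_trans)
  next
    fix y
    assume y: "y \<in> carrier G"
    obtain p where p: "\<And>B. B \<in> \<C> \<Longrightarrow> p B \<in> B" using sets by (metis ex_in_conv)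
    have pG: "p B \<in> carrier G" if "B \<in> \<C>" for B using p sets that by blast
    \<comment> \<open>The set \<open>A U\<close> varies with \<open>U\<close> but takes finitely
      many values. One fixed point \<open>p B\<close> in each of them bounds the distance to the
      gate, so finitely many pairs of group elements suffice.\<close>
    have "{U \<in> domains X. dd U (pt U y) (b U) > 4 * c} \<subseteq>
      {U \<in> domains X. dd U (pt U y) (pt U \<one>) > 3 * E} \<union>
      (\<Union>B\<in>\<C>. {U \<in> domains X. dd U (pt U \<one>) (pt U (p B)) > 3 * E})"
    proof
      fix U
      assume "U \<in> {U \<in> domains X. dd U (pt U y) (b U) > 4 * c}"
      then have U: "U \<in> domains X" "dd U (pt U y) (b U) > 4 * c" by auto
      have "dd U (pt U \<one>) (b U) \<le> dd U (pt U \<one>) (pt U (p (A U))) + 1"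
        using gate[OF U(1) p[OF A[OF U(1)]]] by (simp add: b_def)
      then have "dd U (pt U y) (pt U \<one>) > 3 * E \<or> dd U (pt U \<one>) (pt U (p (A U))) > 3 * E"
        using U(2) dd_triangle(1)[OF U(1), of "pt U y" "b U" "pt U \<one>"] c h0 k E by linarith
      then show "U \<in> {U \<in> domains X. dd U (pt U y) (pt U \<one>) > 3 * E} \<union>
        (\<Union>B\<in>\<C>. {U \<in> domains X. dd U (pt U \<one>) (pt U (p B)) > 3 * E})"
        using U(1) A[OF U(1)] by blast
    qed
    moreover have "finite \<dots>"
      by (intro finite_UnI finite_UN_I fin(1) finite_relevant_points y one_closed pG)
    ultimately show "finite {U \<in> domains X. dd U (pt U y) (b U) > 4 * c}" by (rule finite_subset)
  qed (fact dd_sym dd_triangle(1) nest_refl nest_antisym nest_trans nest_minimal orth_commute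
        orth_nest orth_card | use orth_incomparable in blast)+

  obtain y where y: "y \<in> carrier G" "\<And>U. U \<in> domains X \<Longrightarrow> dd U (pt U y) (b U) \<le> 7 * c"
    using tuple.realisation by blast
  have "\<exists>a\<in>B. dd U (pt U y) (pt U a) \<le> 7 * c + h" if U: "U \<in> domains X" and B: "B \<in> \<C>" for U B
  proof -
    obtain a where a: "a \<in> B" "dd U (b U) (pt U a) \<le> h" using near[OF U B] by (auto simp: b_def)
    then have "dd U (pt U y) (pt U a) \<le> 7 * c + h"
      using y(2)[OF U] dd_triangle(1)[OF U, of "pt U y" "pt U a" "b U"] by linarith
    then show ?thesis using a(1) by blast
  qed
  then show ?thesis using y(1) by blast
qed

text \<open>Finite families come first because a farthest coset must exist. The radius of
  \<open>ball\<close> depends on \<open>R\<close> but not on the family, so larger finite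
  subfamilies, and hence infinite families, are excluded.\<close>

lemma hier_quasiconvex_bounded_packing:
  assumes orth_card: "\<And>A. A \<subseteq> domains X \<Longrightarrow> pairwise (orth X) A \<Longrightarrow> finite A \<and> card A \<le> N"
    and H: "subgroup H G" and hq: "hier_quasiconvex G X H"
  shows "bounded_packing G (gens X) H"
  unfolding bounded_packing_def
proof
  fix R :: real
  obtain k where k: "\<And>\<kappa>. 0 \<le> \<kappa> \<Longrightarrow> 0 \<le> k \<kappa>" "hier_quasiconvex_with k G X H"
    using hq unfolding hier_quasiconvex_def by blast
  have qcH: "\<And>W. W \<in> domains X \<Longrightarrow> quasiconvex (space_of X W) (k 0) (proj_set X W H)"
    using k(2) unfolding hier_quasiconvex_with_def by blast
  have HG: "H \<subseteq> carrier G" using H by (rule subgroup.subset)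
  \<comment> \<open>The Lipschitz bound contributes E(|R| + 1) + E and representatives 2E. Using |R|
    + 1 provides points of two cosets realising the bound strictly and keeps \<open>r\<close>
    nonnegative for negative \<open>R\<close>.\<close>
  define r where "r = E * (\<bar>R\<bar> + 1) + 3 * E"
  define h where "h = helly_const E (k 0 + E) r"
  define c where "c = h + 24 * E + (k 0 + E) + 1"
  define \<theta> where "\<theta> = 7 * c + h"
  define ball where "ball = {g \<in> carrier G. real (word_length G (gens X) g) \<le> k \<theta> + 1}"
  have r0: "0 \<le> r" using E_nonneg by (simp add: r_def)
  have \<theta>0: "0 \<le> \<theta>" using E_nonneg k(1)[of 0] r0 by (simp add: \<theta>_def c_def h_def helly_const_def)
  have coset: "\<exists>g\<in>carrier G. C = g <# H" if "C \<in> lcosets H" for C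
    using that unfolding LCOSETS_def by blast
  have cosetG: "C \<subseteq> carrier G" if "C \<in> lcosets H" for C
    using coset[OF that] HG unfolding l_coset_def by auto
  have bound: "card F \<le> card ball"
    if F: "finite F" "F \<subseteq> lcosets H" and close: "pairwise (\<lambda>C D. sdist (word_dist G (gens X)) C D \<le> R) F" for F
  proof (cases "F = {}")
    case False
    have ne: "C \<noteq> {}" if "C \<in> F" for C
      using coset[of C] that F(2) subgroup.one_closed[OF H] unfolding l_coset_def by blast
    have "\<exists>y\<in>carrier G. \<forall>U\<in>domains X. \<forall>C\<in>F. \<exists>a\<in>C. dd U (pt U y) (pt U a) \<le> \<theta>"
      unfolding \<theta>_def
    proof (rule coarse_helly[OF orth_card _ F(1) False _ _ _ h_def c_def])
      show "0 \<le> k 0 + E" using E_nonneg k(1)[of 0] by simp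
      show "C \<noteq> {} \<and> C \<subseteq> carrier G" if "C \<in> F" for C using that ne F(2) cosetG by blast
      show "quasiconvex (space_of X U) (k 0 + E) (pt U ` C)" if "C \<in> F" "U \<in> domains X" for C U
        using coset[of C] that F(2) coset_quasiconvex[OF H _ that(2) qcH] by blast
      show "\<exists>a\<in>C. \<exists>b\<in>D. dd U (pt U a) (pt U b) \<le> r" if CD: "C \<in> F" "D \<in> F" and U: "U \<in> domains X" for C D U
      proof (cases "C = D")
        case True
        then show ?thesis using ne[OF CD(1)] dd_self[OF U] r0 by (metis ex_in_conv)
      next
        case False
        then have "sdist (word_dist G (gens X)) C D < \<bar>R\<bar> + 1"
          using pairwiseD[OF close CD] by linarith
        then obtain a b where ab: "a \<in> C" "b \<in> D" "word_dist G (gens X) a b < \<bar>R\<bar> + 1"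
          using sdist_attained[of "word_dist G (gens X)", OF word_dist_nonneg ne[OF CD(1)] ne[OF CD(2)]] by blast
        have G: "a \<in> carrier G" "b \<in> carrier G" using ab CD F(2) cosetG by blast+
        have "E * word_dist G (gens X) a b \<le> E * (\<bar>R\<bar> + 1)"
          using ab(3) E_nonneg by (intro mult_left_mono) auto
        then have "dproj X U a b \<le> E * (\<bar>R\<bar> + 1) + E"
          using proj_lipschitz[OF U G] by linarith
        then have "dd U (pt U a) (pt U b) \<le> r" using pt_dist[OF U G] unfolding r_def by force
        then show ?thesis using ab by blast
      qed
    qed auto
    then obtain y where y: "y \<in> carrier G"
      and near: "\<And>U C. U \<in> domains X \<Longrightarrow> C \<in> F \<Longrightarrow> \<exists>a\<in>C. dd U (pt U y) (pt U a) \<le> \<theta>" by blast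
    have "\<exists>s\<in>C. word_dist G (gens X) y s \<le> k \<theta> + 1" if C: "C \<in> F" for C
    proof -
      obtain g where g: "g \<in> carrier G" "C = g <# H" using coset C F(2) by blast
      show ?thesis using coset_near[OF H g(1) y k(2) \<theta>0] near C g(2) by blast
    qed
    then obtain s where s: "\<And>C. C \<in> F \<Longrightarrow> s C \<in> C" "\<And>C. C \<in> F \<Longrightarrow> word_dist G (gens X) y (s C) \<le> k \<theta> + 1"
      by metis
    have sG: "s C \<in> carrier G" if "C \<in> F" for C using s(1)[OF that] cosetG F(2) that by blast
    \<comment> \<open>Distinct left cosets are disjoint, so the chosen points near \<open>y\<close>
      differ; translation by \<open>inv y\<close> then moves them into the ball about the
      identity.\<close>
    have "inj_on (\<lambda>C. inv y \<otimes> s C) F"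
    proof (rule inj_onI)
      fix C D
      assume CD: "C \<in> F" "D \<in> F" "inv y \<otimes> s C = inv y \<otimes> s D"
      then have "s C = s D" using sG y by simp
      then show "C = D" using s(1)[OF CD(1)] s(1)[OF CD(2)] lcos_disjoint[OF H, of C D] CD F(2) by auto
    qed
    moreover have "(\<lambda>C. inv y \<otimes> s C) ` F \<subseteq> ball"
      using s(2) sG y unfolding ball_def word_dist_def by auto
    moreover have "finite ball" unfolding ball_def by (rule finite_word_ball)
    ultimately show ?thesis by (rule card_inj_on_le)
  qed simp
  show "\<exists>N. \<forall>\<C>\<subseteq>lcosets H. pairwise (\<lambda>C D. sdist (word_dist G (gens X)) C D \<le> R) \<C> \<longrightarrow> finite \<C> \<and> card \<C> \<le> N"
  proof (intro exI[of _ "card ball"] allI impI)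
    fix \<C>
    assume \<C>: "\<C> \<subseteq> lcosets H" "pairwise (\<lambda>C D. sdist (word_dist G (gens X)) C D \<le> R) \<C>"
    have sub: "card F \<le> card ball" if "finite F" "F \<subseteq> \<C>" for F
      using bound[OF that(1)] that(2) \<C> pairwise_subset by blast
    have "finite \<C>"
    proof (rule ccontr)
      assume "infinite \<C>"
      then obtain F where "finite F" "card F = Suc (card ball)" "F \<subseteq> \<C>"
        using infinite_arbitrarily_large by blast
      then show False using sub by fastforce
    qed
    then show "finite \<C> \<and> card \<C> \<le> card ball" using sub by blast
  qed
qed

end

text \<open>Transverse domains are never orthogonal, so distinct members of an orthogonal family
  have distinct colours.\<close>

lemma BBF_orth_card:
  assumes BBF: "BBF_colouring G X n \<SS>" and A: "A \<subseteq> domains X" "pairwise (orth X) A"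
  shows "finite A \<and> card A \<le> n"
proof -
  have "\<forall>U\<in>A. \<exists>i\<in>{1..n}. U \<in> \<SS> i" using BBF A(1) unfolding BBF_colouring_def by blast
  then obtain col where col: "\<And>U. U \<in> A \<Longrightarrow> col U \<in> {1..n}" "\<And>U. U \<in> A \<Longrightarrow> U \<in> \<SS> (col U)"
    by metis
  have "inj_on col A"
  proof (rule inj_onI, rule ccontr)
    fix U V
    assume UV: "U \<in> A" "V \<in> A" "col U = col V" "U \<noteq> V"
    have "pairwise (transverse X) (\<SS> (col U))" using BBF col UV unfolding BBF_colouring_def by blast
    then have "transverse X U V" using col(2) UV by (metis pairwiseD)
    then show False using A(2) UV unfolding transverse_def by (meson pairwiseD)
  qed
  moreover have "col ` A \<subseteq> {1..n}" using col by auto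
  ultimately show ?thesis
    using card_inj_on_le[of col A "{1..n}"] inj_on_finite[of col A "{1..n}"] by simp
qed

theorem corollary4p5:
  fixes G :: "('g, 'm) monoid_scheme"
    and X :: "('g, 's, 'p) hhg_data"
    and E L :: real
    and n :: nat
    and \<SS> :: "nat \<Rightarrow> 's set"
    and H :: "'g set"
  assumes "hhg G X E"
    and "BBF_colouring G X n \<SS>"
    and "1 \<le> L"
    and "\<forall>U\<in>domains X. \<exists>(V :: 't set) F f.
           graph_tree V F \<and> quasiisometry_to_graph L (space_of X U) V F f"
    and "subgroup H G"
    and "hier_quasiconvex G X H"
  shows "bounded_packing G (gens X) H"
  using hhg.hier_quasiconvex_bounded_packing[OF assms(1) BBF_orth_card[OF assms(2)] assms(5,6)] .

end
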